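(* Let $t$ be a positive integer and let $\Sigma_t=\{x,z_1,\ldots,z_{t+1}\}$ be an alphabet of $t+2$ distinct letters. Let $L_t=z_1x^*z_2x^*z_3\cdots z_tx^*z_{t+1}\subseteq\Sigma_t^*$, i.e. the set of words $z_1x^{m_1}z_2x^{m_2}\cdots z_tx^{m_t}z_{t+1}$ with $m_1,\ldots,m_t\ge 0$. Then there is an algorithm which, given a monoid morphism $\mu\colon\Sigma_t^*\to\mathbb{Q}^{2\times 2}_{\rm uptr}$ (specified by the rational matrices $\mu(x),\mu(z_1),\ldots,\mu(z_{t+1})$) such that $\mu(z_i)$ is nonsingular for every $i=1,\ldots,t+1$, decides whether the restriction of $\mu$ to $L_t$ is injective.
   Context: $\mathbb{Q}^{2\times 2}_{\rm uptr}$ denotes the monoid (under matrix multiplication) of upper-triangular $2\times 2$ matrices with rational entries. No assumption is made on $\mu(x)$ other than that it is an upper-triangular rational matrix (it may be singular). *)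

theory Defs
  imports "HOL-Analysis.Analysis" "HOL-Library.Nat_Bijection"
begin

datatype recf = Zero | Succ | Proj nat | Comp recf "recf list" | Prim recf recf | Mn recf

inductive reval :: "recf \<Rightarrow> nat list \<Rightarrow> nat \<Rightarrow> bool" where
  reval_zero: "reval Zero xs 0"
| reval_succ: "reval Succ (x # xs) (Suc x)"
| reval_proj: "i < length xs \<Longrightarrow> reval (Proj i) xs (xs ! i)"
| reval_comp: "length ys = length gs \<Longrightarrow> (\<forall>i < length gs. reval (gs ! i) xs (ys ! i))
      \<Longrightarrow> reval f ys z \<Longrightarrow> reval (Comp f gs) xs z"
| reval_prim0: "reval f xs z \<Longrightarrow> reval (Prim f g) (0 # xs) z"
| reval_primS: "reval (Prim f g) (n # xs) y \<Longrightarrow> reval g (y # n # xs) z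
      \<Longrightarrow> reval (Prim f g) (Suc n # xs) z"
| reval_mn: "reval f (n # xs) 0 \<Longrightarrow> (\<forall>k < n. \<exists>y. 0 < y \<and> reval f (k # xs) y)
      \<Longrightarrow> reval (Mn f) xs n"

definition enc_rat :: "rat \<Rightarrow> nat" where
  "enc_rat q = prod_encode (int_encode (fst (quotient_of q)), int_encode (snd (quotient_of q)))"

definition enc_mat :: "rat^2^2 \<Rightarrow> nat" where
  "enc_mat A = list_encode (map enc_rat [A$1$1, A$1$2, A$2$1, A$2$2])"

datatype letter = X | Z nat

definition Sigma :: "nat \<Rightarrow> letter set" where
  "Sigma t = insert X (Z ` {1..t+1})"

definition Lword :: "nat list \<Rightarrow> letter list" where
  "Lword m = concat (map (\<lambda>i. Z (i+1) # replicate (m ! i) X) [0..<length m]) @ [Z (length m + 1)]"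

definition L :: "nat \<Rightarrow> letter list set" where
  "L t = {Lword m | m. length m = t}"

definition mhom :: "(letter \<Rightarrow> rat^2^2) \<Rightarrow> letter list \<Rightarrow> rat^2^2" where
  "mhom mu w = foldr (\<lambda>a M. mu a ** M) w (mat 1)"

definition upper_tri :: "rat^2^2 \<Rightarrow> bool" where
  "upper_tri A \<longleftrightarrow> A$2$1 = 0"

definition enc_input :: "nat \<Rightarrow> (letter \<Rightarrow> rat^2^2) \<Rightarrow> nat" where
  "enc_input t mu = list_encode (map (enc_mat \<circ> mu) (X # map Z [1..<t+2]))"

end

theory Submission
  imports Defs
begin

text \<open>A failure of injectivity is witnessed by two different exponent lists with the same product.
  If such a witness exists, then there is one whose entries are below a bound computable from the
  input, so a bounded search decides the problem.

  Let \<open>a\<close>, \<open>d\<close> be the diagonal of \<open>\<mu>(x)\<close>.  If \<open>t = 1\<close>, \<open>ad = 0\<close> or \<open>a = \<plusminus> d\<close>, a small witness can be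
  written down.  Otherwise both lists have the same sum, \<open>\<mu>(x)\<close> can be diagonalised, and equality of
  the products becomes a linear relation with integer coefficients between powers of the ratio
  \<open>a / d \<noteq> \<plusminus> 1\<close>, whose exponents are the partial sums of the two lists.  If these exponents have a gap that
  is large compared with the exponents below it, the relation splits at the gap, and all exponents
  above it can be lowered by one.  So a minimal relation has no large gaps.\<close>

section \<open>Primitive recursive functions of structured inputs\<close>

text \<open>A given collision cannot be bounded: once the relation splits into vanishing parts, its
  upper block may be shifted freely. Only the existence of a small collision can be proved, by
  compression. The compression acts on exponents, not on lists: one monotone map that fixes 0 and is
  injective on the exponents in use is applied to the partial sums of both lists. Its values are
  again partial sums, the new lists still differ, and their sums still agree.

  The exceptional cases are those where this breaks down. If \<open>a = d\<close>, there is no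
  conjugation to diagonal form in general; instead powers of \<open>x\<close> are linear in the
  exponent up to a scalar, and linear equations replace the power relation. If
  \<open>a = - d\<close> or \<open>ad = 0\<close>, the ratio is \<open>-1\<close>, zero or
  undefined, but by Cayley-Hamilton \<open>x^2\<close> is a multiple of the identity or of
  \<open>x\<close>, which gives a collision outright for \<open>t \<ge> 2\<close>.

  The relation has \<open>2 * (t + 1)\<close> terms, so the bound is an exponential tower of height
  fixed by \<open>t\<close>. Since \<open>t\<close> is fixed before the machine is built, bound and
  search are primitive recursive and no unbounded minimisation occurs.\<close>

text \<open>The input \<open>e\<close> is arbitrary data presented to the machine as the argument list \<open>v e\<close>; nothing is
  required of the machine outside the set \<open>S\<close> of admissible inputs.\<close>

definition computable :: "'e set \<Rightarrow> ('e \<Rightarrow> nat list) \<Rightarrow> ('e \<Rightarrow> nat) \<Rightarrow> bool" where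
  "computable S v f \<longleftrightarrow> (\<exists>k P. \<forall>e\<in>S. length (v e) = k \<and> reval P (v e) (f e))"

definition decidable :: "'e set \<Rightarrow> ('e \<Rightarrow> nat list) \<Rightarrow> ('e \<Rightarrow> bool) \<Rightarrow> bool" where
  "decidable S v Q \<longleftrightarrow> computable S v (\<lambda>e. of_bool (Q e))"

text \<open>The bound variable goes in front because \<open>Prim\<close> recurses on its first
  argument; \<open>S \<times> UNIV\<close> leaves it unrestricted.\<close>

definition ext :: "('e \<Rightarrow> nat list) \<Rightarrow> 'e \<times> nat \<Rightarrow> nat list" where
  "ext v = (\<lambda>(e, i). i # v e)"

lemma computable_cong:
  "(\<And>e. e \<in> S \<Longrightarrow> f e = g e) \<Longrightarrow> computable S v f \<Longrightarrow> computable S v g"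
  unfolding computable_def by metis

lemma reval_comp1: "reval G xs y \<Longrightarrow> reval F [y] z \<Longrightarrow> reval (Comp F [G]) xs z"
  by (rule reval_comp[where ys = "[y]"]) auto

lemma reval_comp2:
  "reval G xs y \<Longrightarrow> reval G' xs y' \<Longrightarrow> reval F [y, y'] z \<Longrightarrow> reval (Comp F [G, G']) xs z"
  by (rule reval_comp[where ys = "[y, y']"]) (auto simp: less_Suc_eq)

lemma reval_proj_eq: "i < length xs \<Longrightarrow> xs ! i = y \<Longrightarrow> reval (Proj i) xs y"
  using reval_proj by blast

lemma reval_select:
  assumes "reval F (map (\<lambda>i. xs ! i) is) z" "\<And>i. i \<in> set is \<Longrightarrow> i < length xs"
  shows "reval (Comp F (map Proj is)) xs z"
  using assms by (intro reval_comp[where ys = "map (\<lambda>i. xs ! i) is"]) (auto intro: reval_proj)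

lemma computable_unary:
  assumes "\<And>x. reval F [x] (g x)" "computable S v f"
  shows "computable S v (\<lambda>e. g (f e))"
  using assms unfolding computable_def by (meson reval_comp1)

lemma computable_binary:
  assumes "\<And>x y. reval F [x, y] (g x y)" "computable S v f" "computable S v f'"
  shows "computable S v (\<lambda>e. g (f e) (f' e))"
proof -
  obtain k P where P: "\<forall>e\<in>S. length (v e) = k \<and> reval P (v e) (f e)"
    using assms(2) unfolding computable_def by blast
  obtain P' where P': "\<forall>e\<in>S. reval P' (v e) (f' e)"
    using assms(3) unfolding computable_def by blast
  have "\<forall>e\<in>S. length (v e) = k \<and> reval (Comp F [P, P']) (v e) (g (f e) (f' e))"
    using P P' assms(1) reval_comp2 by meson
  then show ?thesis unfolding computable_def by blast
qed

lemma reval_const: "\<exists>F. \<forall>xs. reval F xs c"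
proof (induction c)
  case 0
  then show ?case using reval_zero by blast
next
  case (Suc c)
  then show ?case using reval_comp1 reval_succ by blast
qed

text \<open>\<open>f\<close> supplies the common length of the inputs, which is part of
  \<open>computable\<close>.\<close>

lemma computable_const: "computable S v f \<Longrightarrow> computable S v (\<lambda>e. c)"
  using reval_const[of c] unfolding computable_def by blast

lemma computable_Suc: "computable S v f \<Longrightarrow> computable S v (\<lambda>e. Suc (f e))"
  by (rule computable_unary[OF reval_succ])

section \<open>Arithmetic on natural numbers\<close>

definition add_recf :: recf where
  "add_recf = Prim (Proj 0) (Comp Succ [Proj 0])"

lemma reval_add: "reval add_recf [n, m] (n + m)"
  unfolding add_recf_def
proof (induction n)
  case 0
  show ?case by (rule reval_prim0) (rule reval_proj_eq; simp)
next
  case (Suc n)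
  then show ?case
    by (auto intro!: reval_primS reval_comp1 reval_succ intro: reval_proj_eq)
qed

lemma computable_add:
  "computable S v f \<Longrightarrow> computable S v g \<Longrightarrow> computable S v (\<lambda>e. f e + g e)"
  by (rule computable_binary[OF reval_add])

definition mult_recf :: recf where
  "mult_recf = Prim Zero (Comp add_recf [Proj 0, Proj 2])"

lemma reval_mult: "reval mult_recf [n, m] (n * m)"
  unfolding mult_recf_def
proof (induction n)
  case 0
  show ?case by (rule reval_prim0) (simp add: reval_zero)
next
  case (Suc n)
  have "reval (Comp add_recf [Proj 0, Proj 2]) [n * m, n, m] (n * m + m)"
    by (rule reval_comp2[OF _ _ reval_add]; rule reval_proj_eq; simp)
  with Suc show ?case
    by (auto intro!: reval_primS simp: add.commute)
qed

lemma computable_mult: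
  "computable S v f \<Longrightarrow> computable S v g \<Longrightarrow> computable S v (\<lambda>e. f e * g e)"
  by (rule computable_binary[OF reval_mult])

lemma reval_power:
  "reval (Prim (Comp Succ [Zero]) (Comp mult_recf [Proj 0, Proj 2])) [n, m] (m ^ n)"
proof (induction n)
  case 0
  show ?case using reval_prim0[OF reval_comp1[OF reval_zero reval_succ]] by simp
next
  case (Suc n)
  have "reval (Comp mult_recf [Proj 0, Proj 2]) [m ^ n, n, m] (m ^ n * m)"
    by (rule reval_comp2[OF _ _ reval_mult]; rule reval_proj_eq; simp)
  with Suc show ?case
    by (auto intro!: reval_primS simp: mult.commute)
qed

lemma computable_power:
  "computable S v f \<Longrightarrow> computable S v g \<Longrightarrow> computable S v (\<lambda>e. f e ^ g e)"
  by (rule computable_binary[OF reval_power])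

definition pred_recf :: recf where
  "pred_recf = Prim Zero (Proj 1)"

lemma reval_pred: "reval pred_recf [n] (n - 1)"
  unfolding pred_recf_def
proof (induction n)
  case 0
  show ?case by (rule reval_prim0) (simp add: reval_zero)
next
  case (Suc n)
  then show ?case by (auto intro!: reval_primS intro: reval_proj_eq)
qed

lemma reval_diff: "reval (Prim (Proj 0) (Comp pred_recf [Proj 0])) [n, m] (m - n)"
proof (induction n)
  case 0
  show ?case by (rule reval_prim0) (rule reval_proj_eq; simp)
next
  case (Suc n)
  have "reval (Comp pred_recf [Proj 0]) [m - n, n, m] (m - n - 1)"
    by (rule reval_comp1[OF _ reval_pred]; rule reval_proj_eq; simp)
  with Suc show ?case by (auto intro!: reval_primS)
qed

lemma computable_diff:
  "computable S v f \<Longrightarrow> computable S v g \<Longrightarrow> computable S v (\<lambda>e. f e - g e)"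
  by (rule computable_binary[OF reval_diff])

section \<open>Bounded sums, decidable predicates and bounded search\<close>

lemma computable_fst:
  assumes "computable S v f"
  shows "computable (S \<times> UNIV) (ext v) (\<lambda>x. f (fst x))"
proof -
  obtain k P where P: "\<forall>e\<in>S. length (v e) = k \<and> reval P (v e) (f e)"
    using assms unfolding computable_def by blast
  have "map (\<lambda>i. (j # v e) ! i) [1..<Suc k] = v e" if "e \<in> S" for e j
    using P that by (intro nth_equalityI) (auto simp del: upt_Suc)
  then have "\<forall>x\<in>S \<times> UNIV. length (ext v x) = Suc k \<and>
      reval (Comp P (map Proj [1..<Suc k])) (ext v x) (f (fst x))"
    using P by (auto simp: ext_def simp del: upt_Suc intro!: reval_select)
  then show ?thesis unfolding computable_def by blast
qed

lemma computable_snd: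
  assumes "computable S v f"
  shows "computable (S \<times> UNIV) (ext v) snd"
proof -
  obtain k P where P: "\<forall>e\<in>S. length (v e) = k \<and> reval P (v e) (f e)"
    using assms unfolding computable_def by blast
  then have "\<forall>x\<in>S \<times> UNIV. length (ext v x) = Suc k \<and> reval (Proj 0) (ext v x) (snd x)"
    by (auto simp: ext_def intro!: reval_proj_eq)
  then show ?thesis unfolding computable_def by blast
qed

lemma computable_sum:
  assumes b: "computable S v b" and g: "computable (S \<times> UNIV) (ext v) g"
  shows "computable S v (\<lambda>e. \<Sum>i<b e. g (e, i))"
proof -
  obtain k P where P: "\<forall>e\<in>S. length (v e) = k \<and> reval P (v e) (b e)"
    using b unfolding computable_def by blast
  obtain R where R: "\<forall>x\<in>S \<times> UNIV. reval R (ext v x) (g x)"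
    using g unfolding computable_def by blast
  \<comment> \<open>\<open>Prim\<close> puts accumulator and counter in front of the input;
    projecting from position 1 drops the accumulator, so that \<open>R\<close> sees the counter
    followed by \<open>v e\<close>.\<close>
  define step where "step = Comp add_recf [Proj 0, Comp R (map Proj [1..<k + 2])]"
  have loop: "reval (Prim Zero step) (n # v e) (\<Sum>i<n. g (e, i))" if "e \<in> S" for e n
  proof (induction n)
    case 0
    show ?case by (rule reval_prim0) (simp add: reval_zero)
  next
    case (Suc n)
    have len: "length (v e) = k"
      using P that by blast
    let ?xs = "(\<Sum>i<n. g (e, i)) # n # v e"
    have "map (\<lambda>i. ?xs ! i) [1..<k + 2] = n # v e"
      using len by (intro nth_equalityI) (auto simp del: upt_Suc)
    moreover have "reval R (n # v e) (g (e, n))"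
      using R that by (force simp: ext_def)
    ultimately have "reval (Comp R (map Proj [1..<k + 2])) ?xs (g (e, n))"
      using len by (intro reval_select) (auto simp del: upt_Suc)
    then have "reval step ?xs ((\<Sum>i<n. g (e, i)) + g (e, n))"
      unfolding step_def by (intro reval_comp2[OF _ _ reval_add]) (auto intro: reval_proj_eq)
    with Suc show ?case by (auto intro!: reval_primS)
  qed
  have "reval (Comp (Prim Zero step) (P # map Proj [0..<k])) (v e) (\<Sum>i<b e. g (e, i))"
    if e: "e \<in> S" for e
  proof (rule reval_comp)
    show "reval (Prim Zero step) (b e # v e) (\<Sum>i<b e. g (e, i))"
      by (rule loop[OF e])
  qed (use P e in \<open>auto simp: nth_Cons less_Suc_eq_0_disj intro: reval_proj split: nat.split\<close>)
  then show ?thesis using P unfolding computable_def by blast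
qed

lemma decidable_not:
  assumes "decidable S v Q"
  shows "decidable S v (\<lambda>e. \<not> Q e)"
proof -
  note Q = assms[unfolded decidable_def]
  show ?thesis
    using computable_diff[OF computable_const[OF Q, of 1] Q]
    unfolding decidable_def by (rule computable_cong[rotated]) auto
qed

lemma decidable_conj:
  assumes "decidable S v Q" "decidable S v R"
  shows "decidable S v (\<lambda>e. Q e \<and> R e)"
  using computable_mult[OF assms[unfolded decidable_def]]
  unfolding decidable_def by (auto elim!: computable_cong[rotated])

lemma decidable_le:
  assumes "computable S v f" "computable S v g"
  shows "decidable S v (\<lambda>e. f e \<le> g e)"
  using computable_diff[OF computable_const[OF assms(1), of 1] computable_diff[OF assms]]
  unfolding decidable_def by (rule computable_cong[rotated]) auto

lemma decidable_eq:
  assumes "computable S v f" "computable S v g"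
  shows "decidable S v (\<lambda>e. f e = g e)"
  using decidable_conj[OF decidable_le[OF assms] decidable_le[OF assms(2,1)]]
  by (simp add: order_eq_iff)

lemma computable_if:
  assumes "decidable S v Q" "computable S v f" "computable S v g"
  shows "computable S v (\<lambda>e. if Q e then f e else g e)"
  using computable_add[OF computable_mult[OF assms(1)[unfolded decidable_def] assms(2)]
    computable_mult[OF decidable_not[OF assms(1), unfolded decidable_def] assms(3)]]
  by (rule computable_cong[rotated]) auto

lemma decidable_ex:
  assumes b: "computable S v b" and Q: "decidable (S \<times> UNIV) (ext v) Q"
  shows "decidable S v (\<lambda>e. \<exists>i<b e. Q (e, i))"
proof -
  have "of_bool (\<exists>i<n. Q (e, i)) = 1 - (1 - (\<Sum>i<n. of_bool (Q (e, i)) :: nat))" for e n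
  proof -
    have "(\<Sum>i<n. of_bool (Q (e, i)) :: nat) = 0 \<longleftrightarrow> \<not> (\<exists>i<n. Q (e, i))"
      by (auto simp del: sum_of_bool_eq)
    then show ?thesis
      by (cases "(\<Sum>i<n. of_bool (Q (e, i)) :: nat) = 0")
        (simp_all only: of_bool_eq, auto simp del: sum_of_bool_eq sum_eq_0_iff)
  qed
  then show ?thesis
    unfolding decidable_def
    using computable_diff[OF computable_const[OF b] computable_diff[OF computable_const[OF b]
      computable_sum[OF b Q[unfolded decidable_def]]], of 1 1] by (simp only:)
qed

text \<open>Since at most one positive index satisfies \<open>Q\<close>, the sum of all indices
  satisfying it is that index, or 0 if there is none. Index 0 contributes nothing, so
  \<open>Q\<close> is left free there.\<close>

lemma computable_search:
  assumes b: "computable S v b" and Q: "decidable (S \<times> UNIV) (ext v) Q"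
    and f: "\<And>e i. e \<in> S \<Longrightarrow> 0 < i \<Longrightarrow> i < b e \<Longrightarrow> Q (e, i) \<longleftrightarrow> i = f e" "\<And>e. e \<in> S \<Longrightarrow> f e = 0 \<or> f e < b e"
  shows "computable S v f"
proof (rule computable_cong)
  show "computable S v (\<lambda>e. \<Sum>i<b e. (\<lambda>x. of_bool (Q x) * snd x) (e, i))"
    by (intro computable_sum computable_mult computable_snd[OF b] b Q[unfolded decidable_def])
  fix e assume e: "e \<in> S"
  have "of_bool (Q (e, i)) * i = (if i = f e then f e else 0)" if "i < b e" for i
    using f(1)[OF e _ that] by (cases "i = 0") auto
  then have "(\<Sum>i<b e. of_bool (Q (e, i)) * i) = (\<Sum>i<b e. if i = f e then f e else 0)"
    by simp
  also have "\<dots> = f e"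
    using f(2)[OF e] by auto
  finally show "(\<Sum>i<b e. (\<lambda>x. of_bool (Q x) * snd x) (e, i)) = f e"
    by simp
qed

section \<open>Codes of pairs and lists\<close>

lemma computable_triangle:
  assumes "computable S v f"
  shows "computable S v (\<lambda>e. triangle (f e))"
proof -
  have "triangle n = (\<Sum>i<Suc n. i)" for n
    by (induction n) auto
  then show ?thesis
    using computable_sum[OF computable_Suc[OF assms] computable_snd[OF assms]] by simp
qed

lemma computable_prod_encode:
  "computable S v f \<Longrightarrow> computable S v g \<Longrightarrow> computable S v (\<lambda>e. prod_encode (f e, g e))"
  by (simp add: prod_encode_def computable_add computable_triangle)

text \<open>Both components are at most the code, so each is found by a bounded search whose test is
  itself a bounded search for the other one.\<close>

lemma computable_prod_decode:
  assumes c: "computable S v (\<lambda>e. prod_encode (f e, g e))"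
  shows "computable S v f" "computable S v g"
proof -
  let ?c = "\<lambda>e. Suc (prod_encode (f e, g e))"
  note c1 = computable_fst[OF c] and s1 = computable_snd[OF c]
  have lt: "f e < ?c e" "g e < ?c e" for e
    using le_prod_encode_1[of "f e" "g e"] le_prod_encode_2[of "g e" "f e"] by auto
  show "computable S v f"
  proof (rule computable_search[OF computable_Suc[OF c]])
    show "decidable (S \<times> UNIV) (ext v) (\<lambda>x. \<exists>j<?c (fst x).
        (\<lambda>y. prod_encode (snd (fst y), snd y) = prod_encode (f (fst (fst y)), g (fst (fst y)))) (x, j))"
      by (intro decidable_ex decidable_eq computable_prod_encode computable_Suc c1
          computable_fst[OF s1] computable_snd[OF s1] computable_fst[OF c1])
  qed (use lt in auto)
  show "computable S v g"
  proof (rule computable_search[OF computable_Suc[OF c]])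
    show "decidable (S \<times> UNIV) (ext v) (\<lambda>x. \<exists>j<?c (fst x).
        (\<lambda>y. prod_encode (snd y, snd (fst y)) = prod_encode (f (fst (fst y)), g (fst (fst y)))) (x, j))"
      by (intro decidable_ex decidable_eq computable_prod_encode computable_Suc c1
          computable_fst[OF s1] computable_snd[OF s1] computable_fst[OF c1])
  qed (use lt in auto)
qed

lemma computable_pred: "computable S v (\<lambda>e. Suc (f e)) \<Longrightarrow> computable S v f"
  using computable_unary[OF reval_pred, of S v "\<lambda>e. Suc (f e)"] by simp

lemma computable_list_decode:
  assumes "computable S v (\<lambda>e. list_encode (map (\<lambda>f. f e) fs))" "f \<in> set fs"
  shows "computable S v f"
  using assms
proof (induction fs)
  case (Cons g fs)
  have "computable S v (\<lambda>e. prod_encode (g e, list_encode (map (\<lambda>f. f e) fs)))"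
    by (rule computable_pred) (use Cons.prems(1) in simp)
  from computable_prod_decode[OF this] show ?case
    using Cons by auto
qed simp

lemma computable_list_encode:
  "computable S v f \<Longrightarrow> computable S v (\<lambda>e. list_encode (replicate n (f e)))"
  by (induction n) (auto intro: computable_const computable_Suc computable_prod_encode)

section \<open>Integers\<close>

text \<open>Positive and negative part represent an integer uniquely. Any difference of computable
  functions is brought to this form by truncated subtraction in both directions.\<close>

definition computable_int :: "'e set \<Rightarrow> ('e \<Rightarrow> nat list) \<Rightarrow> ('e \<Rightarrow> int) \<Rightarrow> bool" where
  "computable_int S v f \<longleftrightarrow> computable S v (\<lambda>e. nat (f e)) \<and> computable S v (\<lambda>e. nat (- f e))"

lemma computable_int_diff:
  assumes "computable S v f" "computable S v g" "\<And>e. e \<in> S \<Longrightarrow> h e = int (f e) - int (g e)"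
  shows "computable_int S v h"
  unfolding computable_int_def
  using computable_cong[OF _ computable_diff[OF assms(1,2)], of "\<lambda>e. nat (h e)"]
    computable_cong[OF _ computable_diff[OF assms(2,1)], of "\<lambda>e. nat (- h e)"] assms(3) by auto

lemma computable_int_add:
  "computable_int S v f \<Longrightarrow> computable_int S v g \<Longrightarrow> computable_int S v (\<lambda>e. f e + g e)"
  unfolding computable_int_def[of _ _ f] computable_int_def[of _ _ g]
  by (rule computable_int_diff[of _ _ "\<lambda>e. nat (f e) + nat (g e)" "\<lambda>e. nat (- f e) + nat (- g e)"])
    (auto intro: computable_add)

lemma computable_int_mult:
  assumes "computable_int S v f" "computable_int S v g"
  shows "computable_int S v (\<lambda>e. f e * g e)"
proof (rule computable_int_diff)
  show "f e * g e = int (nat (f e) * nat (g e) + nat (- f e) * nat (- g e)) -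
      int (nat (f e) * nat (- g e) + nat (- f e) * nat (g e))" for e
    by (cases "f e \<ge> 0"; cases "g e \<ge> 0") (auto simp: algebra_simps)
qed (use assms in \<open>auto simp: computable_int_def intro: computable_add computable_mult\<close>)

lemma computable_int_sum:
  assumes "computable S v b" "computable_int (S \<times> UNIV) (ext v) f"
  shows "computable_int S v (\<lambda>e. \<Sum>i<b e. f (e, i))"
proof (rule computable_int_diff)
  show "computable S v (\<lambda>e. \<Sum>i<b e. (\<lambda>x. nat (f x)) (e, i))"
    "computable S v (\<lambda>e. \<Sum>i<b e. (\<lambda>x. nat (- f x)) (e, i))"
    using assms by (auto simp: computable_int_def intro!: computable_sum)
  show "(\<Sum>i<b e. f (e, i)) = int (\<Sum>i<b e. nat (f (e, i))) - int (\<Sum>i<b e. nat (- f (e, i)))" for e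
    by (simp flip: sum_subtractf) (intro sum.cong, auto)
qed

lemma decidable_int_eq:
  assumes "computable_int S v f" "computable_int S v g"
  shows "decidable S v (\<lambda>e. f e = g e)"
proof -
  have "f e = g e \<longleftrightarrow> nat (f e) = nat (g e) \<and> nat (- f e) = nat (- g e)" for e
    by auto
  then show ?thesis
    using assms by (auto simp: computable_int_def intro!: decidable_conj decidable_eq)
qed

lemma computable_int_power:
  assumes f: "computable_int S v f" and n: "computable S v n"
  shows "computable_int S v (\<lambda>e. f e ^ n e)"
proof -
  define a where "a e = nat (f e) + nat (- f e)" for e
  \<comment> \<open>The sign of the power: odd exponent and negative base. Parity is tested by a
    bounded search for half of the exponent.\<close>
  define neg where "neg e \<longleftrightarrow> \<not> (\<exists>i<Suc (n e). 2 * i = n e) \<and> \<not> nat (- f e) = 0" for e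
  have f': "computable S v (\<lambda>e. nat (f e))" "computable S v (\<lambda>e. nat (- f e))"
    using f by (auto simp: computable_int_def)
  note n1 = computable_fst[OF n] and s1 = computable_snd[OF n]
  have ex: "decidable S v (\<lambda>e. \<exists>i<Suc (n e). (\<lambda>x. 2 * snd x = n (fst x)) (e, i))"
    by (rule decidable_ex[OF computable_Suc[OF n] decidable_eq[OF computable_mult[OF computable_const[OF s1] s1] n1]])
  have neg: "decidable S v neg"
    unfolding neg_def
    by (intro decidable_conj decidable_not ex[simplified] decidable_eq f' computable_const[OF n])
  have pow: "computable S v (\<lambda>e. a e ^ n e)"
    unfolding a_def by (rule computable_power[OF computable_add[OF f'] n])
  note zero = computable_const[OF n, of 0]
  have "f e ^ n e = int (if neg e then 0 else a e ^ n e) - int (if neg e then a e ^ n e else 0)" for e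
  proof -
    have "(\<exists>i<Suc (n e). 2 * i = n e) \<longleftrightarrow> even (n e)"
      by (auto elim!: evenE) presburger
    then have neg_iff: "neg e \<longleftrightarrow> odd (n e) \<and> f e < 0"
      by (auto simp: neg_def)
    have pow_eq: "x ^ k = (if odd k \<and> x < 0 then - int ((nat x + nat (- x)) ^ k)
        else int ((nat x + nat (- x)) ^ k))" for x :: int and k
    proof (cases "x < 0")
      case True
      then obtain m where "x = - int m" "m > 0"
        by (metis neg_int_cases)
      then show ?thesis by (simp add: uminus_power_if)
    next
      case False
      then obtain m where "x = int m"
        by (metis nonneg_int_cases linorder_not_less)
      then show ?thesis by simp
    qed
    show ?thesis
      unfolding pow_eq[of "f e"] a_def neg_iff by (cases "odd (n e) \<and> f e < 0") simp_all
  qed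
  then show ?thesis
    by (intro computable_int_diff[OF computable_if[OF neg zero pow] computable_if[OF neg pow zero]])
qed

text \<open>\<open>int_encode\<close> sends \<open>n\<close> to \<open>2 * n\<close> and
  \<open>- (n + 1)\<close> to \<open>2 * n + 1\<close>, so doubling a candidate recognises both
  parts of the encoded integer.\<close>

lemma int_encode_eq_iff:
  "2 * j = int_encode i \<longleftrightarrow> i = int j"
  "2 * j = Suc (int_encode i) \<longleftrightarrow> i = - int j \<and> j > 0"
proof -
  consider n where "i = int n" | n where "i = - int (Suc n)"
    by (cases i rule: int_cases)
  then show "2 * j = int_encode i \<longleftrightarrow> i = int j"
    "2 * j = Suc (int_encode i) \<longleftrightarrow> i = - int j \<and> j > 0"
    by cases (auto simp: int_encode_def sum_encode_def, presburger+)
qed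

lemma computable_int_decode:
  assumes c: "computable S v (\<lambda>e. int_encode (f e))"
  shows "computable_int S v f"
  unfolding computable_int_def
proof
  let ?c = "\<lambda>e. Suc (int_encode (f e))"
  note c1 = computable_fst[OF c] and s1 = computable_snd[OF c]
  note two = computable_mult[OF computable_const[OF s1, of 2] s1]
  note [simp] = int_encode_eq_iff
  have lt: "nat (f e) < ?c e" "nat (- f e) < ?c e" for e
    by (auto simp: int_encode_def sum_encode_def)
  show "computable S v (\<lambda>e. nat (f e))"
  proof (rule computable_search[OF computable_Suc[OF c]])
    show "decidable (S \<times> UNIV) (ext v) (\<lambda>x. 2 * snd x = int_encode (f (fst x)))"
      by (intro decidable_eq two c1)
  qed (use lt in auto)
  show "computable S v (\<lambda>e. nat (- f e))"
  proof (rule computable_search[OF computable_Suc[OF c]])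
    show "decidable (S \<times> UNIV) (ext v) (\<lambda>x. 2 * snd x = Suc (int_encode (f (fst x))))"
      by (intro decidable_eq two computable_Suc c1)
  qed (use lt in auto)
qed

section \<open>Relations between powers of a rational number\<close>

lemma abs_sum_mult_le:
  fixes d x :: "'j \<Rightarrow> int"
  assumes "(\<Sum>j\<in>J. \<bar>d j\<bar>) \<le> C" "\<And>j. j \<in> J \<Longrightarrow> \<bar>x j\<bar> \<le> M" "0 \<le> M"
  shows "\<bar>\<Sum>j\<in>J. d j * x j\<bar> \<le> C * M"
proof -
  have "\<bar>\<Sum>j\<in>J. d j * x j\<bar> \<le> (\<Sum>j\<in>J. \<bar>d j\<bar> * M)"
    using assms(2) by (intro order_trans[OF sum_abs] sum_mono) (auto simp: abs_mult intro: mult_left_mono)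
  also have "\<dots> \<le> C * M"
    using assms(1,3) by (simp flip: sum_distrib_right add: mult_right_mono)
  finally show ?thesis .
qed

text \<open>Multiply by \<open>q ^ E\<close>, where \<open>E\<close> bounds all exponents.\<close>

lemma ratio_sum_eq_zero_iff:
  fixes p q :: int
  assumes "q \<noteq> 0" "\<And>j. j \<in> J \<Longrightarrow> e j \<le> E"
  shows "(\<Sum>j\<in>J. of_int (d j) * (of_int p / of_int q :: rat) ^ e j) = 0 \<longleftrightarrow>
    (\<Sum>j\<in>J. d j * (p ^ e j * q ^ (E - e j))) = 0"
proof -
  have "of_int (\<Sum>j\<in>J. d j * (p ^ e j * q ^ (E - e j))) =
      of_int q ^ E * (\<Sum>j\<in>J. of_int (d j) * (of_int p / of_int q :: rat) ^ e j)"
    unfolding of_int_sum sum_distrib_left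
  proof (intro sum.cong refl)
    fix j assume "j \<in> J"
    then have "(of_int q :: rat) ^ E = of_int q ^ e j * of_int q ^ (E - e j)"
      using assms(2) by (simp flip: power_add)
    then show "of_int (d j * (p ^ e j * q ^ (E - e j))) =
        of_int q ^ E * (of_int (d j) * (of_int p / of_int q :: rat) ^ e j)"
      using assms(1) by (simp add: power_divide)
  qed
  then have "of_int (\<Sum>j\<in>J. d j * (p ^ e j * q ^ (E - e j))) = (0 :: rat) \<longleftrightarrow>
      (\<Sum>j\<in>J. of_int (d j) * (of_int p / of_int q :: rat) ^ e j) = 0"
    using assms(1) by simp
  then show ?thesis by (simp only: of_int_eq_0_iff)
qed

lemma less_exp_int: "2 \<le> \<bar>x :: int\<bar> \<Longrightarrow> int n < \<bar>x\<bar> ^ n"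
  using less_exp[of n] power_mono[of 2 "\<bar>x\<bar>" n]
  by (metis of_nat_less_iff of_nat_numeral of_nat_power order_less_le_trans zero_le_numeral)

text \<open>Clearing denominators, the terms with exponent at most \<open>h\<close> give an integer which is bounded
  in terms of \<open>h\<close>.  If a prime divides \<open>p\<close>, the remaining terms make it highly divisible; otherwise
  the ratio has absolute value at most 1/2 and they make it smaller than 1.\<close>
lemma gap_split_coprime:
  fixes p q :: int and d :: "'j \<Rightarrow> int" and e :: "'j \<Rightarrow> nat"
  assumes J: "finite J" and pq: "coprime p q" "p \<noteq> 0" "q \<noteq> 0" "\<bar>p\<bar> \<noteq> \<bar>q\<bar>"
    and K: "\<bar>p\<bar> \<le> int K" "\<bar>q\<bar> \<le> int K" and C: "(\<Sum>j\<in>J. \<bar>d j\<bar>) \<le> int C"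
    and sum: "(\<Sum>j\<in>J. of_int (d j) * (of_int p / of_int q :: rat) ^ e j) = 0"
    and gap: "\<And>j. j \<in> J \<Longrightarrow> e j \<le> h \<or> h + C * K ^ h + 1 < e j"
  shows "(\<Sum>j\<in>{j\<in>J. e j \<le> h}. of_int (d j) * (of_int p / of_int q :: rat) ^ e j) = 0"
proof -
  \<comment> \<open>\<open>G\<close> exceeds the bound \<open>C * K ^ h\<close> on the cleared lower
    part \<open>I\<close>, and \<open>int G < b ^ G\<close> for every integer
    \<open>b \<ge> 2\<close>. The extra element in \<open>E\<close> guarantees
    \<open>h + G < E\<close> even if no term lies above the gap.\<close>
  define G where "G = C * K ^ h + 1"
  define E where "E = Max (e ` J \<union> {h + G + 1})"
  have E: "e j \<le> E" if "j \<in> J" for j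
    unfolding E_def using J that by (intro Max_ge) auto
  have hE: "h + G + 1 \<le> E"
    unfolding E_def using J by (intro Max_ge) auto
  let ?lo = "{j\<in>J. e j \<le> h}" and ?up = "{j\<in>J. \<not> e j \<le> h}"
  define I where "I = (\<Sum>j\<in>?lo. d j * (p ^ e j * q ^ (h - e j)))"
  have up: "h + G < e j" if "j \<in> ?up" for j
    using gap that by (auto simp: G_def)
  have Clo: "(\<Sum>j\<in>?lo. \<bar>d j\<bar>) \<le> int C" and Cup: "(\<Sum>j\<in>?up. \<bar>d j\<bar>) \<le> int C"
    using J by (auto intro!: order_trans[OF sum_mono2 C])
  have "(\<Sum>j\<in>?lo. d j * (p ^ e j * q ^ (E - e j))) = q ^ (E - h) * I"
    unfolding I_def sum_distrib_left
  proof (intro sum.cong refl)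
    fix j assume "j \<in> ?lo"
    then have "q ^ (E - e j) = q ^ (E - h) * q ^ (h - e j)"
      using hE by (simp flip: power_add)
    then show "d j * (p ^ e j * q ^ (E - e j)) = q ^ (E - h) * (d j * (p ^ e j * q ^ (h - e j)))"
      by (simp add: mult_ac)
  qed
  moreover have "(\<Sum>j\<in>J. d j * (p ^ e j * q ^ (E - e j))) = 0"
    by (rule ratio_sum_eq_zero_iff[THEN iffD1, OF pq(3) _ sum]) (rule E)
  moreover have "(\<Sum>j\<in>J. d j * (p ^ e j * q ^ (E - e j))) =
      (\<Sum>j\<in>?lo. d j * (p ^ e j * q ^ (E - e j))) + (\<Sum>j\<in>?up. d j * (p ^ e j * q ^ (E - e j)))"
    using J by (subst sum.union_disjoint[symmetric]) (auto intro: sum.cong)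
  ultimately have split: "q ^ (E - h) * I = - (\<Sum>j\<in>?up. d j * (p ^ e j * q ^ (E - e j)))"
    by simp
  have bound: "\<bar>I\<bar> \<le> int C * int K ^ h"
    unfolding I_def
  proof (rule abs_sum_mult_le[OF Clo])
    fix j assume "j \<in> ?lo"
    then have "int K ^ h = int K ^ e j * int K ^ (h - e j)"
      by (simp flip: power_add)
    then show "\<bar>p ^ e j * q ^ (h - e j)\<bar> \<le> int K ^ h"
      using K by (auto simp: abs_mult power_abs intro!: mult_mono power_mono)
  qed simp
  have "I = 0"
  proof (cases "\<bar>p\<bar> = 1")
    case False
    \<comment> \<open>All upper exponents exceed \<open>G\<close>. As \<open>p\<close> and
      \<open>q\<close> are coprime, the power of \<open>q\<close> on the left can be cancelled, and
      \<open>I\<close> is too small for a nonzero multiple of \<open>p ^ G\<close>.\<close>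
    have "p ^ G dvd q ^ (E - h) * I"
      unfolding split dvd_minus_iff using up
      by (intro dvd_sum dvd_mult dvd_mult2 le_imp_power_dvd) force
    then have "p ^ G dvd I"
      using pq(1) by (simp add: coprime_dvd_mult_right_iff)
    moreover have "\<bar>I\<bar> < \<bar>p ^ G\<bar>"
    proof -
      have "\<bar>I\<bar> \<le> int G"
        using bound by (simp add: G_def)
      also have "\<dots> < \<bar>p\<bar> ^ G"
        using False pq(2) by (intro less_exp_int) auto
      finally show ?thesis by (simp add: power_abs)
    qed
    ultimately show ?thesis
      by (meson dvd_imp_le_int linorder_not_less)
  next
    case True
    then have q2: "2 \<le> \<bar>q\<bar>"
      using pq by auto
    show ?thesis
    proof (rule ccontr)
      assume "I \<noteq> 0"
      \<comment> \<open>A nonzero integer \<open>I\<close> makes the left side of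
        \<open>split\<close> at least \<open>\<bar>q\<bar> ^ (E - h)\<close>, whereas the upper
        terms lose a factor \<open>\<bar>q\<bar> ^ G\<close>, which outweighs
        \<open>C\<close>.\<close>
      then have "\<bar>q\<bar> ^ (E - h) * 1 \<le> \<bar>q\<bar> ^ (E - h) * \<bar>I\<bar>"
        by (intro mult_left_mono) auto
      also have "\<dots> = \<bar>\<Sum>j\<in>?up. d j * (p ^ e j * q ^ (E - e j))\<bar>"
        by (simp only: split abs_minus_cancel flip: abs_mult power_abs)
      also have "\<dots> \<le> int C * \<bar>q\<bar> ^ (E - h - G)"
      proof (rule abs_sum_mult_le[OF Cup])
        fix j assume "j \<in> ?up"
        then show "\<bar>p ^ e j * q ^ (E - e j)\<bar> \<le> \<bar>q\<bar> ^ (E - h - G)"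
          using up[of j] q2 True by (auto simp: abs_mult power_abs intro!: power_increasing)
      qed simp
      also have "\<dots> < \<bar>q\<bar> ^ G * \<bar>q\<bar> ^ (E - h - G)"
      proof (rule mult_strict_right_mono)
        have "1 \<le> K"
          using K(2) q2 by simp
        then have "C * 1 \<le> C * K ^ h"
          by (intro mult_left_mono one_le_power) auto
        then have "int C \<le> int G"
          unfolding G_def by linarith
        also have "int G < \<bar>q\<bar> ^ G"
          by (rule less_exp_int[OF q2])
        finally show "int C < \<bar>q\<bar> ^ G" .
      qed (use pq(3) in simp)
      also have "\<bar>q\<bar> ^ G * \<bar>q\<bar> ^ (E - h - G) = \<bar>q\<bar> ^ (E - h)"
        using hE by (simp flip: power_add)
      finally show False
        by simp
    qed
  qed
  then have "(\<Sum>j\<in>?lo. d j * (p ^ e j * q ^ (h - e j))) = 0"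
    by (simp add: I_def)
  then show ?thesis
    using ratio_sum_eq_zero_iff[OF pq(3), of ?lo e h d p] by simp
qed

text \<open>Dividing by the gcd leaves the ratio unchanged and does not increase absolute values, so
  the same \<open>K\<close> serves the coprime case.\<close>

lemma gap_split:
  fixes p q :: int and d :: "'j \<Rightarrow> int" and e :: "'j \<Rightarrow> nat"
  assumes J: "finite J" and pq: "p \<noteq> 0" "q \<noteq> 0" "\<bar>p\<bar> \<noteq> \<bar>q\<bar>"
    and K: "\<bar>p\<bar> \<le> int K" "\<bar>q\<bar> \<le> int K" and C: "(\<Sum>j\<in>J. \<bar>d j\<bar>) \<le> int C"
    and sum: "(\<Sum>j\<in>J. of_int (d j) * (of_int p / of_int q :: rat) ^ e j) = 0"
    and gap: "\<And>j. j \<in> J \<Longrightarrow> e j \<le> h \<or> h + C * K ^ h + 1 < e j"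
  shows "(\<Sum>j\<in>{j\<in>J. e j \<le> h}. of_int (d j) * (of_int p / of_int q :: rat) ^ e j) = 0"
proof -
  have "gcd p q \<noteq> 0"
    using pq by simp
  then obtain g p' q' where *: "p = p' * g" "q = q' * g" "coprime p' q'" and "g \<noteq> 0"
    using gcd_coprime_exists by blast
  then have nz: "g \<noteq> 0" "p' \<noteq> 0" "q' \<noteq> 0"
    using pq by auto
  have "\<bar>p'\<bar> \<le> \<bar>p\<bar>" "\<bar>q'\<bar> \<le> \<bar>q\<bar>"
    using pq(1,2) *(1,2) by (metis dvd_imp_le_int dvd_triv_left)+
  moreover have "\<bar>p'\<bar> \<noteq> \<bar>q'\<bar>"
    using pq(3) *(1,2) by (metis abs_mult)
  moreover have "(of_int p / of_int q :: rat) = of_int p' / of_int q'"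
    unfolding * using nz by simp
  ultimately show ?thesis
    using gap_split_coprime[OF J *(3) nz(2,3) _ _ _ C, where e = e and h = h and K = K] K sum gap by auto
qed

text \<open>Thresholds for a pigeonhole argument: each step has the length that
  \<open>gap_split\<close> demands above \<open>h = exponent_bound C K k\<close>.\<close>

fun exponent_bound :: "nat \<Rightarrow> nat \<Rightarrow> nat \<Rightarrow> nat" where
  "exponent_bound C K 0 = 0"
| "exponent_bound C K (Suc k) = exponent_bound C K k + C * K ^ exponent_bound C K k + 1"

lemma exponent_bound_mono: "i \<le> k \<Longrightarrow> exponent_bound C K i \<le> exponent_bound C K k"
  by (rule lift_Suc_mono_le) auto

text \<open>If each of the \<open>card A\<close> intervals between consecutive thresholds contained
  an element of \<open>A\<close>, these elements together with \<open>x\<close> would be too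
  many.\<close>

lemma exponent_gap_exists:
  assumes A: "finite A" and x: "x \<in> A" "exponent_bound C K (card A) < x"
  obtains k where "k < card A"
    "\<And>y. y \<in> A \<Longrightarrow> y \<le> exponent_bound C K k \<or> exponent_bound C K (Suc k) < y"
proof (rule ccontr)
  let ?T = "exponent_bound C K" and ?n = "card A"
  assume "\<not> thesis"
  with that have "\<forall>k<?n. \<exists>y\<in>A. ?T k < y \<and> y \<le> ?T (Suc k)"
    by (meson linorder_not_le)
  then obtain f where f: "\<And>k. k < ?n \<Longrightarrow> f k \<in> A \<and> ?T k < f k \<and> f k \<le> ?T (Suc k)"
    by metis
  define g where "g k = (if k < ?n then f k else x)" for k
  have "g i < g k" if "i < k" "k \<le> ?n" for i k
  proof -
    have "g i \<le> ?T (Suc i)"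
      using f that by (simp add: g_def)
    also have "\<dots> \<le> ?T k"
      using that by (intro exponent_bound_mono) auto
    also have "\<dots> < g k"
      using f x that by (cases "k < ?n") (auto simp: g_def)
    finally show ?thesis .
  qed
  then have "inj_on g {..?n}"
    by (intro linorder_inj_onI) (auto simp: less_imp_neq)
  moreover have "g ` {..?n} \<subseteq> A"
    using f x by (auto simp: g_def)
  ultimately have "card {..?n} \<le> ?n"
    using A card_inj_on_le by blast
  then show False by simp
qed

text \<open>Across a large gap the equation splits into two, so the upper block of exponents can be
  lowered by one.\<close>
lemma compress_exponents:
  fixes p q :: int and d :: "'j \<Rightarrow> int" and e :: "'j \<Rightarrow> nat"
  assumes J: "finite J" and pq: "p \<noteq> 0" "q \<noteq> 0" "\<bar>p\<bar> \<noteq> \<bar>q\<bar>"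
    and K: "\<bar>p\<bar> \<le> int K" "\<bar>q\<bar> \<le> int K" and C: "(\<Sum>j\<in>J. \<bar>d j\<bar>) \<le> int C"
    and sum: "(\<Sum>j\<in>J. of_int (d j) * (of_int p / of_int q :: rat) ^ e j) = 0"
  shows "\<exists>\<phi>. mono \<phi> \<and> \<phi> 0 = 0 \<and> inj_on \<phi> (e ` J) \<and>
    (\<Sum>j\<in>J. of_int (d j) * (of_int p / of_int q :: rat) ^ \<phi> (e j)) = 0 \<and>
    (\<forall>j\<in>J. \<phi> (e j) \<le> exponent_bound C K (card J))"
  using sum
proof (induction "\<Sum>j\<in>J. e j" arbitrary: e rule: less_induct)
  case less
  let ?T = "exponent_bound C K" and ?r = "of_int p / of_int q :: rat"
  show ?case
  proof (cases "\<forall>j\<in>J. e j \<le> ?T (card J)")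
    case True
    then show ?thesis
      using less.prems by (intro exI[of _ id]) (auto simp: mono_def)
  next
    case False
    then obtain j0 where j0: "j0 \<in> J" "?T (card J) < e j0"
      by force
    have "?T (card (e ` J)) < e j0"
      using j0(2) exponent_bound_mono[OF card_image_le[OF J]] by (meson order_le_less_trans)
    with j0 J obtain k where k: "k < card (e ` J)"
      and gap: "\<And>j. j \<in> J \<Longrightarrow> e j \<le> ?T k \<or> ?T (Suc k) < e j"
      by (elim exponent_gap_exists[of "e ` J" "e j0", rotated 2]) auto
    define h where "h = ?T k"
    \<comment> \<open>Both blocks vanish separately, and the upper one has a nonzero factor
      \<open>?r\<close> to spare. \<open>j0\<close> lies in it, so the sum of the exponents
      decreases.\<close>
    define \<sigma> where "\<sigma> x = (if h < x then x - 1 else x)" for x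
    have gap': "e j \<le> h \<or> h + C * K ^ h + 1 < e j" if "j \<in> J" for j
      using gap[OF that] by (auto simp: h_def)
    have hj0: "h < e j0"
      using j0 k exponent_bound_mono[of k "card J" C K] card_image_le[OF J, of e] by (simp add: h_def)
    have lo: "(\<Sum>j\<in>{j\<in>J. e j \<le> h}. of_int (d j) * ?r ^ e j) = 0"
      by (rule gap_split[OF J pq K C less.prems]) (rule gap')
    have parts: "(\<Sum>j\<in>J. f j) = (\<Sum>j\<in>{j\<in>J. e j \<le> h}. f j) + (\<Sum>j\<in>{j\<in>J. \<not> e j \<le> h}. f j)"
      for f :: "'j \<Rightarrow> rat"
      using J by (subst sum.union_disjoint[symmetric]) (auto intro: sum.cong)
    have "?r \<noteq> 0"
      using pq by simp
    have "(\<Sum>j\<in>{j\<in>J. \<not> e j \<le> h}. of_int (d j) * ?r ^ e j) =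
        ?r * (\<Sum>j\<in>{j\<in>J. \<not> e j \<le> h}. of_int (d j) * ?r ^ \<sigma> (e j))"
      unfolding sum_distrib_left
    proof (intro sum.cong refl)
      fix j assume "j \<in> {j\<in>J. \<not> e j \<le> h}"
      then have "e j = Suc (\<sigma> (e j))"
        by (auto simp: \<sigma>_def)
      then show "of_int (d j) * ?r ^ e j = ?r * (of_int (d j) * ?r ^ \<sigma> (e j))"
        by (metis mult.left_commute power_Suc)
    qed
    then have "(\<Sum>j\<in>{j\<in>J. \<not> e j \<le> h}. of_int (d j) * ?r ^ \<sigma> (e j)) = 0"
      using less.prems lo parts[of "\<lambda>j. of_int (d j) * ?r ^ e j"] \<open>?r \<noteq> 0\<close> by simp
    moreover have "(\<Sum>j\<in>{j\<in>J. e j \<le> h}. of_int (d j) * ?r ^ \<sigma> (e j)) = 0"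
      using lo by (simp add: \<sigma>_def)
    ultimately have sum': "(\<Sum>j\<in>J. of_int (d j) * ?r ^ \<sigma> (e j)) = 0"
      by (simp add: parts)
    have "(\<Sum>j\<in>J. \<sigma> (e j)) < (\<Sum>j\<in>J. e j)"
      using j0 hj0 J by (intro sum_strict_mono_ex1) (auto simp: \<sigma>_def)
    from less.hyps[OF this sum'] obtain \<phi> where \<phi>: "mono \<phi>" "\<phi> 0 = 0" "inj_on \<phi> ((\<lambda>j. \<sigma> (e j)) ` J)"
      "(\<Sum>j\<in>J. of_int (d j) * ?r ^ \<phi> (\<sigma> (e j))) = 0"
      "\<forall>j\<in>J. \<phi> (\<sigma> (e j)) \<le> ?T (card J)"
      by blast
    have "mono \<sigma>"
      by (auto simp: mono_def \<sigma>_def)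
    \<comment> \<open>The gap is wider than one, so lowered exponents stay above \<open>h\<close>
      and the two blocks do not meet.\<close>
    moreover have "inj_on \<sigma> (e ` J)"
    proof (rule linorder_inj_onI)
      fix x y assume "x < y" "x \<in> e ` J" "y \<in> e ` J"
      then obtain i j where "x = e i" "y = e j" "i \<in> J" "j \<in> J" "e i < e j"
        by auto
      then show "\<sigma> x \<noteq> \<sigma> y"
        using gap'[of i] gap'[of j] by (auto simp: \<sigma>_def)
    qed auto
    ultimately show ?thesis
      using \<phi> by (intro exI[of _ "\<phi> \<circ> \<sigma>"])
        (auto simp: mono_def \<sigma>_def[of 0] image_image intro!: comp_inj_on)
  qed
qed

section \<open>Bounded witnesses\<close>

definition utm :: "'a \<Rightarrow> 'a \<Rightarrow> 'a \<Rightarrow> 'a::comm_ring_1^2^2" where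
  "utm a b d = vector [vector [a, b], vector [0, d]]"

lemma utm_nth [simp]:
  "utm a b d $ 1 $ 1 = a" "utm a b d $ 1 $ 2 = b" "utm a b d $ 2 $ 1 = 0" "utm a b d $ 2 $ 2 = d"
  by (simp_all add: utm_def)

lemma utm_eq_iff [simp]: "utm a b d = utm a' b' d' \<longleftrightarrow> a = a' \<and> b = b' \<and> d = d'"
  by (metis utm_nth)

lemma utm_mult [simp]: "utm a b d ** utm a' b' d' = utm (a * a') (a * b' + b * d') (d * d')"
  by (simp add: vec_eq_iff forall_2 matrix_matrix_mult_def sum_2)

lemma mat_1_utm: "mat 1 = utm 1 0 1"
  by (simp add: vec_eq_iff forall_2 mat_def)

lemma upper_tri_eq_utm: "upper_tri A \<Longrightarrow> A = utm (A$1$1) (A$1$2) (A$2$2)"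
  by (simp add: vec_eq_iff forall_2 upper_tri_def)

primrec mpow :: "rat^2^2 \<Rightarrow> nat \<Rightarrow> rat^2^2" where
  "mpow x 0 = mat 1"
| "mpow x (Suc n) = x ** mpow x n"

text \<open>The geometric sum is kept without dividing by \<open>a - d\<close>, so the formula
  covers equal eigenvalues and has computable numerators over a common denominator.\<close>

lemma mpow_utm: "mpow (utm a b d) n = utm (a ^ n) (\<Sum>i<n. a ^ i * b * d ^ (n - 1 - i)) (d ^ n)"
proof (induction n)
  case 0
  then show ?case by (simp add: mat_1_utm)
next
  case (Suc n)
  have "(\<Sum>i<Suc n. a ^ i * b * d ^ (Suc n - 1 - i)) = b * d ^ n + a * (\<Sum>i<n. a ^ i * b * d ^ (n - 1 - i))"
    by (simp add: sum.lessThan_Suc_shift sum_distrib_left mult_ac del: sum.lessThan_Suc)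
  with Suc show ?case by simp
qed

lemma mpow_utm_equal:
  assumes "a \<noteq> 0"
  shows "mpow (utm a b a) n = utm (a ^ n) (of_nat n * (b / a) * a ^ n) (a ^ n)"
  by (induction n) (use assms in \<open>auto simp: mat_1_utm field_simps\<close>)

primrec wmat :: "rat^2^2 \<Rightarrow> (nat \<Rightarrow> rat^2^2) \<Rightarrow> nat list \<Rightarrow> nat \<Rightarrow> rat^2^2" where
  "wmat x z [] k = z k"
| "wmat x z (m # ms) k = z k ** (mpow x m ** wmat x z ms (Suc k))"

definition collision :: "rat^2^2 \<Rightarrow> (nat \<Rightarrow> rat^2^2) \<Rightarrow> nat \<Rightarrow> nat list \<Rightarrow> nat list \<Rightarrow> bool" where
  "collision x z t m m' \<longleftrightarrow>
    length m = t \<and> length m' = t \<and> m \<noteq> m' \<and> wmat x z m 1 = wmat x z m' 1"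

definition collision_below :: "rat^2^2 \<Rightarrow> (nat \<Rightarrow> rat^2^2) \<Rightarrow> nat \<Rightarrow> nat \<Rightarrow> bool" where
  "collision_below x z t b \<longleftrightarrow>
    (\<exists>m m'. collision x z t m m' \<and> (\<forall>i \<in> set m \<union> set m'. i \<le> b))"

lemma collision_below_mono: "collision_below x z t b \<Longrightarrow> b \<le> c \<Longrightarrow> collision_below x z t c"
  unfolding collision_below_def by (meson order_trans)

text \<open>A relation around \<open>z 2\<close> suffices: padding both lists with zeros adds the
  same factors on either side.\<close>

lemma collision_below_2:
  assumes "2 \<le> t" "mpow x i ** z 2 ** mpow x j = mpow x i' ** z 2 ** mpow x j'"
    "(i, j) \<noteq> (i', j')" "max (max i j) (max i' j') \<le> b"
  shows "collision_below x z t b"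
proof -
  have *: "wmat x z (l # k # n) 1 = z 1 ** ((mpow x l ** z 2 ** mpow x k) ** wmat x z n 3)" for l k n
    by (simp add: matrix_mul_assoc numeral_2_eq_2 numeral_3_eq_3)
  let ?r = "replicate (t - 2) (0::nat)"
  have "collision x z t (i # j # ?r) (i' # j' # ?r)"
    unfolding collision_def * using assms by simp
  then show ?thesis
    unfolding collision_below_def using assms(4)
    by (intro exI[of _ "i # j # ?r"] exI[of _ "i' # j' # ?r"]) auto
qed

lemma collision_below_3:
  assumes "3 \<le> t" "mpow x i ** z 2 ** mpow x j ** z 3 ** mpow x k =
      mpow x i' ** z 2 ** mpow x j' ** z 3 ** mpow x k'"
    "(i, j, k) \<noteq> (i', j', k')" "max (max i (max j k)) (max i' (max j' k')) \<le> b"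
  shows "collision_below x z t b"
proof -
  have *: "wmat x z (l # l' # l'' # n) 1 =
      z 1 ** ((mpow x l ** z 2 ** mpow x l' ** z 3 ** mpow x l'') ** wmat x z n 4)" for l l' l'' n
    by (simp add: matrix_mul_assoc numeral_2_eq_2 numeral_3_eq_3 eval_nat_numeral)
  let ?r = "replicate (t - 3) (0::nat)"
  have "collision x z t (i # j # k # ?r) (i' # j' # k' # ?r)"
    unfolding collision_def * using assms by simp
  then show ?thesis
    unfolding collision_below_def using assms(4)
    by (intro exI[of _ "i # j # k # ?r"] exI[of _ "i' # j' # k' # ?r"]) auto
qed

section \<open>Exceptional cases: a single power of \<open>x\<close>, a singular \<open>x\<close>,
  eigenvalues equal up to sign\<close>

lemma power_eq_imp_trivial:
  assumes "(x::rat) ^ m = x ^ n" "m \<noteq> n"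
  shows "x = 0 \<or> \<bar>x\<bar> = 1"
proof (rule ccontr)
  assume *: "\<not> ?thesis"
  have "\<bar>x\<bar> ^ m = \<bar>x\<bar> ^ n"
    using assms(1) by (metis power_abs)
  moreover have "\<bar>x\<bar> > 0" "\<bar>x\<bar> \<noteq> 1"
    using * by auto
  ultimately show False
    using assms(2) power_inject_exp'[of "\<bar>x\<bar>" m n] by blast
qed

text \<open>The outer factors cancel, so two powers of \<open>x\<close> coincide and its eigenvalues
  are 0, 1 or -1. For such an \<open>x\<close> a coincidence already occurs among the exponents 0 to
  3.\<close>

lemma collision_below_1:
  assumes z: "z 1 = utm p q r" "z 2 = utm p' q' r'" and nz: "p \<noteq> 0" "r \<noteq> 0" "p' \<noteq> 0" "r' \<noteq> 0"
    and c: "collision (utm a b d) z 1 m m'"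
  shows "collision_below (utm a b d) z 1 3"
proof -
  let ?x = "utm a b d"
  have w: "wmat ?x z [n] 1 = z 1 ** (mpow ?x n ** z 2)" for n
    by (simp add: numeral_2_eq_2)
  obtain n n' where n: "m = [n]" "m' = [n']" "n \<noteq> n'"
    using c by (auto simp: collision_def length_Suc_conv)
  then have eq: "mpow ?x n = mpow ?x n'"
    using c nz unfolding collision_def n w mpow_utm z by auto
  have ad: "a = 0 \<or> a = 1 \<or> a = - 1" "d = 0 \<or> d = 1 \<or> d = - 1"
    using eq n(3) power_eq_imp_trivial[of _ n n'] by (force simp: mpow_utm)+
  have pow: "mpow ?x 2 = utm (a\<^sup>2) (b * (a + d)) (d\<^sup>2)"
    "mpow ?x 3 = utm (a^3) (b * (a\<^sup>2 + a * d + d\<^sup>2)) (d^3)" "mpow ?x 1 = ?x"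
    by (simp_all add: eval_nat_numeral mat_1_utm algebra_simps)
  have "b = 0" if "a = d" "a \<noteq> 0"
    using eq that n(3) by (auto simp: mpow_utm_equal)
  then have "mpow ?x 2 = mpow ?x 3 \<or> mpow ?x 1 = mpow ?x 3 \<or> mpow ?x 0 = mpow ?x 2"
    using ad unfolding pow by (auto simp: mat_1_utm)
  then obtain k k' where "mpow ?x k = mpow ?x k'" "k \<noteq> k'" "k \<le> 3" "k' \<le> 3"
    by - (elim disjE; erule that; simp)
  then show ?thesis
    unfolding collision_below_def collision_def using w
    by (intro exI[of _ "[k]"] exI[of _ "[k']"]) auto
qed

text \<open>With determinant 0, Cayley-Hamilton gives \<open>x^2 = (a + d) x\<close>, so the scalar
  can be moved from one side of \<open>z 2\<close> to the other.\<close>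

lemma collision_below_singular:
  assumes "2 \<le> t" "a * d = 0" "z 2 = utm p q r"
  shows "collision_below (utm a b d) z t 2"
proof (rule collision_below_2[where i = 1 and j = 2 and i' = 2 and j' = 1])
  have "a = 0 \<or> d = 0"
    using assms(2) by simp
  then show "mpow (utm a b d) 1 ** z 2 ** mpow (utm a b d) 2 =
      mpow (utm a b d) 2 ** z 2 ** mpow (utm a b d) 1"
    unfolding assms(3) by (elim disjE) (simp_all add: numeral_2_eq_2 mat_1_utm algebra_simps)
qed (use assms in auto)

text \<open>Trace 0 makes \<open>x^2\<close> the scalar matrix \<open>a^2\<close>, which commutes
  with \<open>z 2\<close>.\<close>

lemma collision_below_opposite:
  assumes "2 \<le> t" "z 2 = utm p q r"
  shows "collision_below (utm a b (- a)) z t 2"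
proof (rule collision_below_2[where i = 2 and j = 0 and i' = 0 and j' = 2])
  show "mpow (utm a b (- a)) 2 ** z 2 ** mpow (utm a b (- a)) 0 =
      mpow (utm a b (- a)) 0 ** z 2 ** mpow (utm a b (- a)) 2"
    unfolding assms(2) by (simp add: numeral_2_eq_2 mat_1_utm algebra_simps)
qed (use assms in auto)

text \<open>Here \<open>x\<close> is \<open>a\<close> times a unipotent matrix: apart from the
  scalar \<open>a ^ (i + j)\<close>, only the corner depends on the exponents, and it does so
  linearly.\<close>

lemma block_2:
  assumes "a \<noteq> 0"
  shows "mpow (utm a b a) i ** utm p q r ** mpow (utm a b a) j =
    utm (a ^ (i + j) * p) (a ^ (i + j) * (q + b / a * (of_nat j * p + of_nat i * r))) (a ^ (i + j) * r)"
  by (simp add: mpow_utm_equal[OF assms] power_add algebra_simps)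

lemma block_3:
  assumes "a \<noteq> 0"
  shows "mpow (utm a b a) i ** utm p q r ** mpow (utm a b a) j ** utm p' q' r' ** mpow (utm a b a) k =
    utm (a ^ (i + j + k) * p * p')
      (a ^ (i + j + k) * (p * q' + q * r' + b / a * (of_nat i * r * r' + of_nat j * p * r' + of_nat k * p * p')))
      (a ^ (i + j + k) * r * r')"
  unfolding block_2[OF assms] by (simp add: mpow_utm_equal[OF assms] power_add algebra_simps)

text \<open>By \<open>block_3\<close> it is enough that the three differences of exponents satisfy
  two homogeneous linear equations: total 0 and weighted total 0. Three unknowns leave a nonzero
  integer solution, whose positive and negative parts are the two triples. Its entries are
  differences of products bounded by \<open>N\<^sup>2\<close>.\<close>

lemma collision_below_equal_3:
  fixes P R D P' R' D' :: int
  assumes t: "3 \<le> t" and a: "a \<noteq> 0" and N: "1 \<le> N"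
    and z: "z 2 = utm (of_int P / of_int D) q (of_int R / of_int D)"
      "z 3 = utm (of_int P' / of_int D') q' (of_int R' / of_int D')"
    and bounds: "\<bar>P\<bar> \<le> int N" "\<bar>R\<bar> \<le> int N" "\<bar>P'\<bar> \<le> int N" "\<bar>R'\<bar> \<le> int N"
  shows "collision_below (utm a b a) z t (2 * N\<^sup>2)"
proof -
  define w1 w2 w3 where w: "w1 = R * R'" "w2 = P * R'" "w3 = P * P'"
  have wN: "\<bar>w1\<bar> \<le> int (N\<^sup>2)" "\<bar>w2\<bar> \<le> int (N\<^sup>2)" "\<bar>w3\<bar> \<le> int (N\<^sup>2)"
    using bounds by (auto simp: w abs_mult power2_eq_square intro!: mult_mono)
  obtain \<delta>1 \<delta>2 \<delta>3 :: int where \<delta>: "\<delta>1 + \<delta>2 + \<delta>3 = 0" "\<delta>1 * w1 + \<delta>2 * w2 + \<delta>3 * w3 = 0"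
    "(\<delta>1, \<delta>2, \<delta>3) \<noteq> (0, 0, 0)" "\<bar>\<delta>1\<bar> \<le> int (2 * N\<^sup>2)" "\<bar>\<delta>2\<bar> \<le> int (2 * N\<^sup>2)" "\<bar>\<delta>3\<bar> \<le> int (2 * N\<^sup>2)"
  proof (cases "w1 = w2 \<and> w2 = w3")
    case True
    have "1 \<le> N\<^sup>2"
      using N by simp
    then have "1 \<le> 2 * int (N\<^sup>2)"
      by linarith
    then show ?thesis
      using True by (intro that[of 1 "- 1" 0]) auto
  next
    case False
    \<comment> \<open>the cross product of \<open>(1, 1, 1)\<close> and \<open>(w1, w2, w3)\<close>, up to sign\<close>
    then show ?thesis
      using wN by (intro that[of "w2 - w3" "w3 - w1" "w1 - w2"]) (auto simp: algebra_simps)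
  qed
  have split: "rat_of_int x = of_nat (nat x) - of_nat (nat (- x))" for x
    by (cases "x \<ge> 0") auto
  have nat_le: "nat x \<le> k" "nat (- x) \<le> k" if "\<bar>x\<bar> \<le> int k" for x k
    using that by linarith+
  have sum_eq: "nat \<delta>1 + nat \<delta>2 + nat \<delta>3 = nat (- \<delta>1) + nat (- \<delta>2) + nat (- \<delta>3)"
    using \<delta>(1) by linarith
  have w_eq: "of_nat (nat \<delta>1) * of_int w1 + of_nat (nat \<delta>2) * of_int w2 + of_nat (nat \<delta>3) * of_int w3 =
      (of_nat (nat (- \<delta>1)) * of_int w1 + of_nat (nat (- \<delta>2)) * of_int w2 + of_nat (nat (- \<delta>3)) * of_int w3 :: rat)"
  proof -
    have "rat_of_int \<delta>1 * of_int w1 + of_int \<delta>2 * of_int w2 + of_int \<delta>3 * of_int w3 = 0"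
      using \<delta>(2) by (metis of_int_0 of_int_add of_int_mult)
    then show ?thesis
      unfolding split[of \<delta>1] split[of \<delta>2] split[of \<delta>3] by (simp add: algebra_simps)
  qed
  have frac: "of_nat i * (of_int R / of_int D) * (of_int R' / of_int D') +
      of_nat j * (of_int P / of_int D) * (of_int R' / of_int D') +
      of_nat k * (of_int P / of_int D) * (of_int P' / of_int D') =
      (of_nat i * of_int w1 + of_nat j * of_int w2 + of_nat k * of_int w3 :: rat) / (of_int D * of_int D')" for i j k
    by (simp add: w add_divide_distrib)
  show ?thesis
  proof (rule collision_below_3[OF t])
    show "mpow (utm a b a) (nat \<delta>1) ** z 2 ** mpow (utm a b a) (nat \<delta>2) ** z 3 ** mpow (utm a b a) (nat \<delta>3) =
        mpow (utm a b a) (nat (- \<delta>1)) ** z 2 ** mpow (utm a b a) (nat (- \<delta>2)) ** z 3 ** mpow (utm a b a) (nat (- \<delta>3))"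
      unfolding z block_3[OF a] frac sum_eq w_eq ..
    have "nat x = nat (- x) \<longleftrightarrow> x = 0" for x
      by linarith
    then show "(nat \<delta>1, nat \<delta>2, nat \<delta>3) \<noteq> (nat (- \<delta>1), nat (- \<delta>2), nat (- \<delta>3))"
      using \<delta>(3) by (simp only: prod.inject) simp
  qed (simp add: nat_le[OF \<delta>(4)] nat_le[OF \<delta>(5)] nat_le[OF \<delta>(6)] del: nat_le_iff)
qed

text \<open>Even exponents remove the scalar power of \<open>a\<close>, so the total need not be
  preserved. The one remaining equation in two unknowns is solved by the differences
  \<open>2 * P\<close> and \<open>- 2 * R\<close>, split into positive and negative parts.\<close>

lemma collision_below_equal_unit:
  fixes P R D :: int
  assumes t: "2 \<le> t" and a: "\<bar>a\<bar> = 1" and N: "1 \<le> N"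
    and z: "z 2 = utm (of_int P / of_int D) q (of_int R / of_int D)" and nz: "P \<noteq> 0"
    and bounds: "\<bar>P\<bar> \<le> int N" "\<bar>R\<bar> \<le> int N"
  shows "collision_below (utm a b a) z t (2 * N\<^sup>2)"
proof -
  have a0: "a \<noteq> 0"
    using a by auto
  have pow: "a ^ (2 * i + 2 * j) = 1" for i j
    using a by (auto simp: abs_eq_iff' power_add)
  have split: "rat_of_int x = of_nat (nat x) - of_nat (nat (- x))" for x
    by (cases "x \<ge> 0") auto
  have eq: "of_nat (2 * nat (- R)) * (of_int P / of_int D) + of_nat (2 * nat P) * (of_int R / of_int D) =
    (of_nat (2 * nat R) * (of_int P / of_int D) + of_nat (2 * nat (- P)) * (of_int R / of_int D) :: rat)"
  proof -
    have "of_int P * (of_int R / of_int D) = of_int R * (of_int P / of_int D :: rat)"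
      by simp
    then have "(of_nat (nat P) - of_nat (nat (- P))) * (of_int R / of_int D) =
        (of_nat (nat R) - of_nat (nat (- R))) * (of_int P / of_int D :: rat)"
      by (simp only: split[symmetric])
    then show ?thesis
      by (simp only: left_diff_distrib of_nat_mult of_nat_numeral mult.assoc)
  qed
  have "N \<le> N\<^sup>2"
    using N by (simp add: power2_eq_square)
  show ?thesis
  proof (rule collision_below_2[OF t])
    show "mpow (utm a b a) (2 * nat P) ** z 2 ** mpow (utm a b a) (2 * nat (- R)) =
        mpow (utm a b a) (2 * nat (- P)) ** z 2 ** mpow (utm a b a) (2 * nat R)"
      unfolding z block_2[OF a0] pow eq ..
  qed (use bounds nz \<open>N \<le> N\<^sup>2\<close> in auto)
qed

text \<open>For \<open>t = 2\<close> and \<open>\<bar>a\<bar> \<noteq> 1\<close> a collision need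
  not exist. A given one has equal totals, which forces \<open>b = 0\<close> or equal diagonal
  entries of \<open>z 2\<close>; then \<open>x\<close> and \<open>z 2\<close> commute, which is a
  collision with exponents 0 and 1.\<close>

lemma collision_below_equal:
  fixes P R D :: "nat \<Rightarrow> int"
  assumes t: "2 \<le> t" and a: "a \<noteq> 0" and N: "1 \<le> N"
    and z: "\<And>i. i \<in> {1..t + 1} \<Longrightarrow> z i = utm (of_int (P i) / of_int (D i)) (q i) (of_int (R i) / of_int (D i))"
    and nz: "\<And>i. i \<in> {1..t + 1} \<Longrightarrow> P i \<noteq> 0 \<and> R i \<noteq> 0 \<and> D i \<noteq> 0"
    and bounds: "\<And>i. i \<in> {1..t + 1} \<Longrightarrow> \<bar>P i\<bar> \<le> int N \<and> \<bar>R i\<bar> \<le> int N"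
    and c: "collision (utm a b a) z t m m'"
  shows "collision_below (utm a b a) z t (2 * N\<^sup>2)"
proof (cases "3 \<le> t \<or> \<bar>a\<bar> = 1")
  case True
  then show ?thesis
  proof
    assume "3 \<le> t"
    then show ?thesis
      using collision_below_equal_3[where b = b and z = z, OF _ a N z[of 2] z[of 3]] bounds[of 2] bounds[of 3] by simp
  next
    assume "\<bar>a\<bar> = 1"
    then show ?thesis
      using collision_below_equal_unit[where b = b and z = z, OF t _ N z[of 2]] t nz[of 2] bounds[of 2] by simp
  qed
next
  case False
  then have t2: "t = 2"
    using t by simp
  let ?x = "utm a b a"
  obtain p2 r2 where z2: "z 2 = utm p2 (q 2) r2"
    using z[of 2] t by auto
  obtain p1 q1 r1 where z1: "z 1 = utm p1 q1 r1" "p1 \<noteq> 0" "r1 \<noteq> 0"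
    using z[of 1] nz[of 1] by auto
  obtain p3 q3 r3 where z3: "z 3 = utm p3 q3 r3" "p3 \<noteq> 0" "r3 \<noteq> 0"
    using z[of 3] nz[of 3] t2 by auto
  obtain i j i' j' where m: "m = [i, j]" "m' = [i', j']" "(i, j) \<noteq> (i', j')"
    using c by (auto simp: collision_def t2 length_Suc_conv numeral_2_eq_2)
  have w: "wmat ?x z [k, l] 1 = z 1 ** (mpow ?x k ** z 2 ** mpow ?x l ** z 3)" for k l
    by (simp add: matrix_mul_assoc numeral_2_eq_2 numeral_3_eq_3)
  have eq: "z 1 ** (mpow ?x i ** z 2 ** mpow ?x j ** z 3) = z 1 ** (mpow ?x i' ** z 2 ** mpow ?x j' ** z 3)"
    using c by (simp only: collision_def m w)
  then have block: "mpow ?x i ** z 2 ** mpow ?x j = mpow ?x i' ** z 2 ** mpow ?x j'"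
    unfolding z1 z2 z3 block_2[OF a] utm_mult utm_eq_iff using z1(2,3) z3(2,3) by auto
  have "p2 \<noteq> 0"
    using z[of 2] nz[of 2] t2 z2 by auto
  then have "a ^ (i + j) = a ^ (i' + j')"
    using block unfolding z2 block_2[OF a] utm_eq_iff by auto
  then have sum: "i + j = i' + j'"
    using power_eq_imp_trivial False a by blast
  then have "b = 0 \<or> of_nat j * p2 + of_nat i * r2 = of_nat j' * p2 + of_nat i' * r2"
    using block a unfolding z2 block_2[OF a] utm_eq_iff by auto
  moreover have "p2 = r2" if "of_nat j * p2 + of_nat i * r2 = of_nat j' * p2 + of_nat i' * r2"
  proof -
    have "rat_of_nat i + of_nat j = of_nat i' + of_nat j'"
      using sum by (metis of_nat_add)
    \<comment> \<open>The totals agree but the lists differ, so \<open>j \<noteq> j'\<close> and the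
      other factor vanishes.\<close>
    then have "(of_nat j - of_nat j') * (p2 - r2) = 0"
      using that by algebra
    then show ?thesis
      using m(3) sum by auto
  qed
  ultimately have "b = 0 \<or> p2 = r2"
    by blast
  then have "mpow ?x 1 ** z 2 ** mpow ?x 0 = mpow ?x 0 ** z 2 ** mpow ?x 1"
    unfolding z2 block_2[OF a] by auto
  then show ?thesis
    using N t by (intro collision_below_2[where i = 1 and j = 0 and i' = 0 and j' = 1]) auto
qed

section \<open>The generic case: nonzero eigenvalues of different absolute value\<close>

text \<open>The conjugate of \<open>utm a s d\<close> by the unipotent matrix \<open>utm 1 u 1\<close>.\<close>
definition cutm :: "rat \<Rightarrow> rat \<Rightarrow> rat \<Rightarrow> rat \<Rightarrow> rat^2^2" where
  "cutm u a s d = utm a (s + u * (a - d)) d"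

lemma cutm_mult: "cutm u a s d ** cutm u a' s' d' = cutm u (a * a') (a * s' + s * d') (d * d')"
  by (simp add: cutm_def algebra_simps)

lemma cutm_eq_iff: "cutm u a s d = cutm u a' s' d' \<longleftrightarrow> a = a' \<and> s = s' \<and> d = d'"
  by (auto simp: cutm_def)

lemma mpow_cutm: "mpow (cutm u a 0 d) n = cutm u (a ^ n) 0 (d ^ n)"
proof (induction n)
  case 0
  show ?case by (simp add: mat_1_utm cutm_def)
qed (simp add: cutm_mult)

text \<open>The corner of a product of triangular matrices is a sum over the position where the path
  jumps from the first to the second coordinate; here it jumps at letter \<open>k + i\<close>. The
  type is general because rational entries and their integer numerators are both inserted.\<close>

definition corner_coeff ::
  "(nat \<Rightarrow> 'a::comm_monoid_mult) \<Rightarrow> (nat \<Rightarrow> 'a) \<Rightarrow> (nat \<Rightarrow> 'a) \<Rightarrow> nat \<Rightarrow> nat \<Rightarrow> nat \<Rightarrow> 'a" where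
  "corner_coeff p s r k n i = (\<Prod>j<i. p (k + j)) * s (k + i) * (\<Prod>j=Suc i..n. r (k + j))"

lemma corner_coeff_0: "corner_coeff p s r k (Suc n) 0 = s k * (\<Prod>j\<le>n. r (Suc k + j))"
  unfolding corner_coeff_def prod.atLeast_Suc_atMost_Suc_shift by (simp add: atLeast0AtMost)

lemma corner_coeff_Suc:
  "corner_coeff p s r k (Suc n) (Suc i) = p k * corner_coeff p s r (Suc k) n i"
  unfolding corner_coeff_def prod.atLeast_Suc_atMost_Suc_shift prod.lessThan_Suc_shift
  by (simp add: mult_ac)

text \<open>A diagonal \<open>x\<close> allows no jump, so there is one summand per letter
  \<open>z\<close>: powers of \<open>x\<close> before the jump contribute \<open>a\<close>, those
  after it \<open>d\<close>.\<close>

lemma wmat_cutm: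
  assumes "\<forall>i\<in>{k..k + length ms}. z i = cutm u (p i) (s i) (r i)"
  shows "wmat (cutm u a 0 d) z ms k = cutm u ((\<Prod>j\<le>length ms. p (k + j)) * a ^ sum_list ms)
    (\<Sum>i\<le>length ms. corner_coeff p s r k (length ms) i * (a ^ sum_list (take i ms) * d ^ sum_list (drop i ms)))
    ((\<Prod>j\<le>length ms. r (k + j)) * d ^ sum_list ms)"
  using assms
proof (induction ms arbitrary: k)
  case Nil
  then show ?case by (simp add: corner_coeff_def)
next
  case (Cons m ms)
  have zk: "z k = cutm u (p k) (s k) (r k)"
    using Cons.prems by simp
  have "\<forall>i\<in>{Suc k..Suc k + length ms}. z i = cutm u (p i) (s i) (r i)"
    using Cons.prems by simp
  note IH = Cons.IH[OF this]
  let ?n = "length ms"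
  have prods: "(\<Prod>j\<le>Suc ?n. f (k + j)) = f k * (\<Prod>j\<le>?n. f (Suc k + j))" for f :: "nat \<Rightarrow> rat"
    unfolding prod.atMost_Suc_shift by simp
  show ?case
    unfolding wmat.simps zk mpow_cutm IH cutm_mult cutm_eq_iff list.size prods add_0_right add_Suc_right
      sum.atMost_Suc_shift corner_coeff_0 corner_coeff_Suc
    by (simp add: power_add mult_ac sum_distrib_left)
qed

text \<open>The differences telescope; monotonicity keeps the subtraction of naturals exact.\<close>

lemma sum_list_take_diff:
  assumes "mono g" "g 0 = 0" "i \<le> t"
  shows "sum_list (take i (map (\<lambda>i. g (Suc i) - g i) [0..<t])) = (g i :: nat)"
  using assms(3)
proof (induction i)
  case (Suc i)
  then show ?case
    using monoD[OF assms(1), of i "Suc i"] by (simp add: take_Suc_conv_app_nth)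
qed (simp add: assms(2))

lemma sum_list_take_inject:
  fixes m m' :: "nat list"
  assumes "length m = t" "length m' = t" "\<And>i. i \<le> t \<Longrightarrow> sum_list (take i m) = sum_list (take i m')"
  shows "m = m'"
proof (rule nth_equalityI)
  fix i assume "i < length m"
  then show "m ! i = m' ! i"
    using assms(1,2) assms(3)[of i] assms(3)[of "Suc i"] by (simp add: take_Suc_conv_app_nth)
qed (use assms in simp)

lemma sum_bool_prod: "(\<Sum>x\<in>{..t} \<times> UNIV. f x) = (\<Sum>i\<le>(t::nat). f (i, True) + f (i, False))"
  by (simp add: sum.cartesian_product[symmetric, of "\<lambda>i b. f (i, b)", simplified] UNIV_bool add.commute)

text \<open>Each of the \<open>t + 1\<close> integer coefficients is at most
  \<open>4 * N ^ (t + 2)\<close>: \<open>t\<close> diagonal factors and a corner of size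
  \<open>4 * N\<^sup>2\<close>. Each occurs once for either list, hence the factor 8 and the
  \<open>2 * (t + 1)\<close> terms.\<close>

definition generic_bound :: "nat \<Rightarrow> nat \<Rightarrow> nat" where
  "generic_bound t N = exponent_bound (8 * (t + 1) * N ^ (t + 2)) N (2 * (t + 1))"

text \<open>Conjugating by a unipotent matrix makes \<open>x\<close> diagonal.  The corner entry of the product is then
  a fixed combination of powers of the ratio of the two eigenvalues, whose exponents are the
  partial sums of the list \<open>m\<close>.\<close>
lemma collision_below_generic:
  fixes P Q R D :: "nat \<Rightarrow> int" and A B E Dx :: int
  assumes x: "x = utm (of_int A / of_int Dx) (of_int B / of_int Dx) (of_int E / of_int Dx)"
    and x_nz: "Dx \<noteq> 0" "A \<noteq> 0" "E \<noteq> 0" "\<bar>A\<bar> \<noteq> \<bar>E\<bar>"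
    and x_le: "\<bar>A\<bar> \<le> int N" "\<bar>B\<bar> \<le> int N" "\<bar>E\<bar> \<le> int N"
    and z: "\<And>i. i \<in> {1..t + 1} \<Longrightarrow>
      z i = utm (of_int (P i) / of_int (D i)) (of_int (Q i) / of_int (D i)) (of_int (R i) / of_int (D i))"
    and z_nz: "\<And>i. i \<in> {1..t + 1} \<Longrightarrow> P i \<noteq> 0 \<and> R i \<noteq> 0 \<and> D i \<noteq> 0"
    and z_le: "\<And>i. i \<in> {1..t + 1} \<Longrightarrow> \<bar>P i\<bar> \<le> int N \<and> \<bar>Q i\<bar> \<le> int N \<and> \<bar>R i\<bar> \<le> int N"
    and c: "collision x z t m m'"
  shows "collision_below x z t (generic_bound t N)"
proof -
  define a d where ad: "a = rat_of_int A / of_int Dx" "d = rat_of_int E / of_int Dx"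
  \<comment> \<open>The solution of \<open>u * (a - d) = B / Dx\<close>, which removes the corner of
    \<open>x\<close>.\<close>
  define u where "u = rat_of_int B / of_int (A - E)"
  define p r where pr: "p i = rat_of_int (P i) / of_int (D i)" "r i = rat_of_int (R i) / of_int (D i)" for i
  define S where "S i = (A - E) * Q i - B * (P i - R i)" for i
  define s where "s i = rat_of_int (S i) / (of_int (D i) * of_int (A - E))" for i
  define coef where "coef i = corner_coeff p s r 1 t i" for i
  define C where "C i = corner_coeff P S R 1 t i" for i
  \<comment> \<open>Every coefficient takes one entry from each \<open>z\<close>, exactly one of
    them a conjugated corner. So all share this denominator.\<close>
  define \<kappa> where "\<kappa> = (\<Prod>j\<le>t. rat_of_int (D (1 + j))) * of_int (A - E)"
  define \<rho> where "\<rho> = rat_of_int A / of_int E"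
  have AE: "A - E \<noteq> 0" "rat_of_int A - of_int E \<noteq> 0"
    using x_nz(4) by (auto simp flip: of_int_diff)
  have nz: "a \<noteq> 0" "d \<noteq> 0" "\<rho> = a / d"
    using x_nz by (auto simp: ad \<rho>_def)
  have x': "x = cutm u a 0 d"
    unfolding x cutm_def ad u_def using AE x_nz(1) by (simp add: field_simps)
  have z': "z i = cutm u (p i) (s i) (r i)" if "i \<in> {1..1 + t}" for i
  proof -
    define \<Delta> where "\<Delta> = rat_of_int (A - E)"
    have *: "\<Delta> \<noteq> 0" "D i \<noteq> 0"
      using AE z_nz[of i] that by (simp_all add: \<Delta>_def)
    have s_eq: "s i = (\<Delta> * of_int (Q i) - of_int B * (of_int (P i) - of_int (R i))) / (of_int (D i) * \<Delta>)"
      by (simp only: s_def S_def \<Delta>_def of_int_diff of_int_mult)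
    have u_eq: "u = of_int B / \<Delta>"
      by (simp only: u_def \<Delta>_def)
    from * have "s i + u * (p i - r i) = of_int (Q i) / of_int (D i)"
      unfolding s_eq u_eq pr by (simp add: field_simps)
    then show ?thesis
      using z[of i] that by (simp add: cutm_def pr)
  qed
  \<comment> \<open>The corner divided by \<open>d ^ sum_list ms\<close>: what remains are powers of
    the ratio at the partial sums.\<close>
  define T where "T ms = (\<Sum>i\<le>t. coef i * \<rho> ^ sum_list (take i ms))" for ms
  have w: "wmat x z ms 1 = cutm u ((\<Prod>j\<le>t. p (1 + j)) * a ^ sum_list ms) (d ^ sum_list ms * T ms)
      ((\<Prod>j\<le>t. r (1 + j)) * d ^ sum_list ms)" if "length ms = t" for ms
  proof -
    have "a ^ sum_list (take i ms) * d ^ sum_list (drop i ms) = d ^ sum_list ms * \<rho> ^ sum_list (take i ms)" for i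
    proof -
      have "sum_list ms = sum_list (take i ms) + sum_list (drop i ms)"
        by (metis append_take_drop_id sum_list_append)
      then show ?thesis
        using nz by (simp add: power_add power_divide)
    qed
    then show ?thesis
      using wmat_cutm[of 1 ms z u p s r a d] z' that
      by (simp add: x' T_def coef_def sum_distrib_left mult_ac)
  qed
  have pr_nz: "(\<Prod>j\<le>t. p (1 + j)) \<noteq> 0" "(\<Prod>j\<le>t. r (1 + j)) \<noteq> 0"
    using z_nz by (auto simp: pr)
  have eq_iff: "wmat x z ms 1 = wmat x z ms' 1 \<longleftrightarrow> sum_list ms = sum_list ms' \<and> T ms = T ms'"
    if "length ms = t" "length ms' = t" for ms ms'
  proof -
    \<comment> \<open>One of the two eigenvalues has pairwise distinct powers, so the diagonal of
      the product determines the total.\<close>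
    have "\<not> (\<bar>a\<bar> = 1 \<and> \<bar>d\<bar> = 1)"
      using x_nz by (auto simp: ad abs_divide field_simps simp flip: of_int_abs)
    then have "sum_list ms = sum_list ms'"
      if "a ^ sum_list ms = a ^ sum_list ms'" "d ^ sum_list ms = d ^ sum_list ms'"
      using that nz power_eq_imp_trivial by blast
    then show ?thesis
      using nz pr_nz unfolding w[OF that(1)] w[OF that(2)] cutm_eq_iff by auto
  qed
  have C_coef: "of_int (C i) = \<kappa> * coef i" if "i \<le> t" for i
  proof -
    have "{..t} = {..<i} \<union> {i} \<union> {Suc i..t}" "{..<i} \<inter> {Suc i..t} = {}"
      using that by auto
    then have "(\<Prod>j\<le>t. rat_of_int (D (1 + j))) =
        (\<Prod>j<i. rat_of_int (D (1 + j))) * of_int (D (1 + i)) * (\<Prod>j=Suc i..t. rat_of_int (D (1 + j)))"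
      by (simp add: prod.union_disjoint)
    moreover have "D (1 + j) \<noteq> 0" if "j \<le> t" for j
      using z_nz that by simp
    ultimately show ?thesis
      using AE that by (simp add: C_def coef_def corner_coeff_def \<kappa>_def pr s_def prod_dividef)
  qed
  have "\<kappa> \<noteq> 0"
    using z_nz AE by (simp add: \<kappa>_def)
  \<comment> \<open>Terms are indexed by position and list, with opposite signs for the two lists,
    so equal exponents need not be merged.\<close>
  define J where "J = {..t} \<times> (UNIV :: bool set)"
  define dj where "dj j = (if snd j then C (fst j) else - C (fst j))" for j :: "nat \<times> bool"
  define ej where "ej j = sum_list (take (fst j) (if snd j then m else m'))" for j :: "nat \<times> bool"
  have T_iff: "T ms = T ms' \<longleftrightarrow>
      (\<Sum>j\<in>J. of_int (dj j) * \<rho> ^ sum_list (take (fst j) (if snd j then ms else ms'))) = 0" for ms ms'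
  proof -
    have "(\<Sum>j\<in>J. of_int (dj j) * \<rho> ^ sum_list (take (fst j) (if snd j then ms else ms'))) =
        \<kappa> * (T ms - T ms')"
      unfolding J_def sum_bool_prod T_def right_diff_distrib sum_distrib_left sum_subtractf[symmetric]
      by (intro sum.cong) (simp_all add: dj_def C_coef)
    then show ?thesis
      using \<open>\<kappa> \<noteq> 0\<close> by simp
  qed
  have C_le: "\<bar>C i\<bar> \<le> int (4 * N ^ (t + 2))" if "i \<le> t" for i
  proof -
    have "\<bar>(A - E) * Q (1 + i) - B * (P (1 + i) - R (1 + i))\<bar> \<le> (int N + int N) * int N + int N * (int N + int N)"
      using x_le z_le[of "1 + i"] that
      by (intro order_trans[OF abs_triangle_ineq4] add_mono) (auto simp: abs_mult intro!: mult_mono)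
    moreover have "\<bar>\<Prod>j<i. P (1 + j)\<bar> \<le> (\<Prod>j<i. int N)" "\<bar>\<Prod>j=Suc i..t. R (1 + j)\<bar> \<le> (\<Prod>j=Suc i..t. int N)"
      unfolding abs_prod using z_le that by (intro prod_mono; simp)+
    ultimately have "\<bar>C i\<bar> \<le> int N ^ i * ((int N + int N) * int N + int N * (int N + int N)) * int N ^ (t - i)"
      unfolding C_def corner_coeff_def S_def abs_mult by (intro mult_mono) auto
    also have "\<dots> = 4 * (int N ^ i * int N ^ (t - i) * int N ^ 2)"
      by (simp add: algebra_simps power2_eq_square)
    also have "int N ^ i * int N ^ (t - i) * int N ^ 2 = int N ^ (t + 2)"
      using that by (simp flip: power_add)
    finally show ?thesis by simp
  qed
  have "(\<Sum>j\<in>J. \<bar>dj j\<bar>) = (\<Sum>i\<le>t. 2 * \<bar>C i\<bar>)"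
    unfolding J_def sum_bool_prod by (simp add: dj_def)
  also have "\<dots> \<le> (\<Sum>i\<le>t. 2 * int (4 * N ^ (t + 2)))"
    by (intro sum_mono mult_left_mono C_le) auto
  also have "\<dots> = int (8 * (t + 1) * N ^ (t + 2))"
    by (simp add: algebra_simps)
  finally have dj_le: "(\<Sum>j\<in>J. \<bar>dj j\<bar>) \<le> int (8 * (t + 1) * N ^ (t + 2))" .
  have len: "length m = t" "length m' = t" and "m \<noteq> m'" and eq: "sum_list m = sum_list m'" "T m = T m'"
    using c eq_iff by (auto simp: collision_def)
  have J: "finite J" "card J = 2 * (t + 1)"
    by (auto simp: J_def card_cartesian_product)
  have "(\<Sum>j\<in>J. of_int (dj j) * (of_int A / of_int E) ^ ej j) = (0 :: rat)"
    using eq(2) unfolding T_iff ej_def \<rho>_def .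
  from compress_exponents[OF J(1) x_nz(2-4) x_le(1,3) dj_le this]
  obtain \<phi> where \<phi>: "mono \<phi>" "\<phi> 0 = 0" "inj_on \<phi> (ej ` J)"
    "(\<Sum>j\<in>J. of_int (dj j) * \<rho> ^ \<phi> (ej j)) = 0" "\<forall>j\<in>J. \<phi> (ej j) \<le> generic_bound t N"
    unfolding J(2) generic_bound_def \<rho>_def by blast
  \<comment> \<open>The list whose partial sums are the compressed partial sums of
    \<open>ms\<close>; both lists use the same \<open>\<phi>\<close>.\<close>
  define f where "f ms = map (\<lambda>i. \<phi> (sum_list (take (Suc i) ms)) - \<phi> (sum_list (take i ms))) [0..<t]" for ms
  have take_mono: "sum_list (take i ms) \<le> sum_list (take j ms)" if "i \<le> j" for i j and ms :: "nat list"
  proof -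
    have "take j ms = take i ms @ take (j - i) (drop i ms)"
      using that by (metis le_add_diff_inverse take_add)
    then show ?thesis by simp
  qed
  have take_f: "sum_list (take i (f ms)) = \<phi> (sum_list (take i ms))" if "i \<le> t" for i ms
    unfolding f_def using that \<phi>(1,2) take_mono
    by (intro sum_list_take_diff[of "\<lambda>i. \<phi> (sum_list (take i ms))"]) (auto simp: mono_def)
  have len_f: "length (f ms) = t" for ms
    by (simp add: f_def)
  have sum_f: "sum_list (f ms) = \<phi> (sum_list ms)" if "length ms = t" for ms
    using take_f[of t ms] len_f[of ms] that by simp
  have ej: "ej (i, True) = sum_list (take i m)" "ej (i, False) = sum_list (take i m')" for i
    by (simp_all add: ej_def)
  have "f m \<noteq> f m'"
  proof
    assume "f m = f m'"
    \<comment> \<open>Equal compressed partial sums were equal before, as \<open>\<phi>\<close> is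
      injective on the exponents of both lists together.\<close>
    then have "sum_list (take i m) = sum_list (take i m')" if "i \<le> t" for i
      using take_f[OF that, of m] take_f[OF that, of m'] that
        inj_onD[OF \<phi>(3), of "ej (i, True)" "ej (i, False)"] by (simp add: ej[symmetric] J_def)
    then show False
      using sum_list_take_inject[OF len] \<open>m \<noteq> m'\<close> by blast
  qed
  moreover have "T (f m) = T (f m')"
    unfolding T_iff using \<phi>(4)
    by (rule trans[rotated]) (intro sum.cong, auto simp: J_def ej_def take_f)
  ultimately have "collision x z t (f m) (f m')"
    using len eq(1) by (simp add: collision_def eq_iff len_f sum_f del: One_nat_def)
  moreover have "i \<le> generic_bound t N" if "i \<in> set (f m) \<union> set (f m')" for i
  proof -
    \<comment> \<open>The last partial sum is the total, which bounds every entry.\<close>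
    have "(t, b) \<in> J" for b
      by (simp add: J_def)
    then have "\<phi> (sum_list m) \<le> generic_bound t N" "\<phi> (sum_list m') \<le> generic_bound t N"
      using \<phi>(5) ej[of t] len by (metis take_all order_refl)+
    then show ?thesis
      using that member_le_sum_list[of i "f m"] member_le_sum_list[of i "f m'"] sum_f len
      by fastforce
  qed
  ultimately show ?thesis
    unfolding collision_below_def by blast
qed

text \<open>A sum dominates the bounds of all cases and is directly computable.\<close>

definition collision_bound :: "nat \<Rightarrow> nat \<Rightarrow> nat" where
  "collision_bound t N = 3 + 2 * N\<^sup>2 + generic_bound t N"

lemma collision_imp_below:
  fixes P Q R D :: "nat \<Rightarrow> int" and A B E Dx :: int
  assumes t: "1 \<le> t" and N: "1 \<le> N"
    and x: "x = utm (of_int A / of_int Dx) (of_int B / of_int Dx) (of_int E / of_int Dx)" "Dx \<noteq> 0"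
    and x_le: "\<bar>A\<bar> \<le> int N" "\<bar>B\<bar> \<le> int N" "\<bar>E\<bar> \<le> int N"
    and z: "\<And>i. i \<in> {1..t + 1} \<Longrightarrow>
      z i = utm (of_int (P i) / of_int (D i)) (of_int (Q i) / of_int (D i)) (of_int (R i) / of_int (D i))"
    and z_nz: "\<And>i. i \<in> {1..t + 1} \<Longrightarrow> P i \<noteq> 0 \<and> R i \<noteq> 0 \<and> D i \<noteq> 0"
    and z_le: "\<And>i. i \<in> {1..t + 1} \<Longrightarrow> \<bar>P i\<bar> \<le> int N \<and> \<bar>Q i\<bar> \<le> int N \<and> \<bar>R i\<bar> \<le> int N"
    and c: "collision x z t m m'"
  shows "collision_below x z t (collision_bound t N)"
proof (cases "t = 1")
  case True
  then have "collision_below x z t 3"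
    using collision_below_1[OF z[of 1] z[of 2]] z_nz[of 1] z_nz[of 2] c x(1) by simp
  then show ?thesis
    by (rule collision_below_mono) (simp add: collision_bound_def)
next
  case False
  then have t2: "2 \<le> t"
    using t by simp
  have z2: "z 2 = utm (of_int (P 2) / of_int (D 2)) (of_int (Q 2) / of_int (D 2)) (of_int (R 2) / of_int (D 2))"
    using z[of 2] t2 by simp
  consider "A = 0 \<or> E = 0" | "A = - E" | "A = E" "E \<noteq> 0" | "A \<noteq> 0" "E \<noteq> 0" "\<bar>A\<bar> \<noteq> \<bar>E\<bar>"
    by linarith
  then show ?thesis
  proof cases
    case 1
    then have "collision_below x z t 2"
      unfolding x(1) using t2 z2 by (intro collision_below_singular) auto
    then show ?thesis
      by (rule collision_below_mono) (simp add: collision_bound_def)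
  next
    case 2
    then have "collision_below x z t 2"
      using collision_below_opposite[where z = z, OF t2 z2, of "of_int A / of_int Dx"] t2 unfolding x(1) by simp
    then show ?thesis
      by (rule collision_below_mono) (simp add: collision_bound_def)
  next
    case 3
    have "collision_below (utm (of_int E / of_int Dx) (of_int B / of_int Dx) (of_int E / of_int Dx)) z t (2 * N\<^sup>2)"
      using z z_nz z_le N t2 3 c x by (intro collision_below_equal[where P = P and R = R and D = D]) auto
    then have "collision_below x z t (2 * N\<^sup>2)"
      using 3 x by simp
    then show ?thesis
      by (rule collision_below_mono) (simp add: collision_bound_def)
  next
    case 4
    have "collision_below x z t (generic_bound t N)"
      by (rule collision_below_generic[OF x 4 x_le z z_nz z_le c])
    then show ?thesis
      by (rule collision_below_mono) (simp add: collision_bound_def)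
  qed
qed

section \<open>From words of the language to exponent lists\<close>

lemma mhom_append: "mhom mu (u @ w) = mhom mu u ** mhom mu w"
  by (induction u) (simp_all add: mhom_def matrix_mul_assoc)

lemma mhom_replicate: "mhom mu (replicate n X) = mpow (mu X) n"
  by (induction n) (simp_all add: mhom_def)

text \<open>\<open>Lword\<close> in recursive form; the free start index makes induction on the list
  possible.\<close>

primrec zword :: "nat list \<Rightarrow> nat \<Rightarrow> letter list" where
  "zword [] k = [Z k]"
| "zword (m # ms) k = Z k # replicate m X @ zword ms (Suc k)"

lemma Lword_eq_zword: "Lword m = zword m 1"
proof -
  have "concat (map (\<lambda>i. Z (i + k) # replicate (m ! i) X) [0..<length m]) @ [Z (length m + k)] = zword m k" for k
  proof (induction m arbitrary: k)
    case (Cons l m)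
    have "[0..<Suc (length m)] = 0 # map Suc [0..<length m]"
      by (simp add: map_Suc_upt upt_conv_Cons del: upt_Suc)
    then show ?case
      using Cons.IH[of "Suc k"] by (simp add: comp_def del: upt_Suc)
  qed simp
  from this[of 1] show ?thesis
    by (simp add: Lword_def)
qed

lemma mhom_Lword: "mhom mu (Lword m) = wmat (mu X) (\<lambda>i. mu (Z i)) m 1"
proof -
  have "mhom mu (zword m k) = wmat (mu X) (\<lambda>i. mu (Z i)) m k" for k
  proof (induction m arbitrary: k)
    case Nil
    show ?case by (simp add: mhom_def)
  next
    case (Cons l m)
    have "mhom mu (zword (l # m) k) = mu (Z k) ** mhom mu (replicate l X @ zword m (Suc k))"
      by (simp add: mhom_def)
    then show ?case
      using Cons by (simp add: mhom_append mhom_replicate)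
  qed
  then show ?thesis
    by (simp only: Lword_eq_zword)
qed

lemma replicate_append_eq_iff:
  assumes "u = [] \<or> hd u \<noteq> a" "w = [] \<or> hd w \<noteq> a"
  shows "replicate i a @ u = replicate j a @ w \<longleftrightarrow> i = j \<and> u = w"
proof (induction i arbitrary: j)
  case 0
  show ?case using assms by (cases j) auto
next
  case (Suc i)
  then show ?case using assms by (cases j) auto
qed

text \<open>Every run of \<open>X\<close> is followed by a letter \<open>Z\<close>, so its length
  can be read off. Hence different exponent lists are different words, and injectivity on the
  language is the absence of collisions.\<close>

lemma zword_inject: "length m = length m' \<Longrightarrow> zword m k = zword m' k \<Longrightarrow> m = m'"
proof (induction m m' arbitrary: k rule: list_induct2)
  case (Cons l m l' m')
  have hd: "hd (zword ms j) \<noteq> X" for ms j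
    by (cases ms) auto
  show ?case
    using Cons.prems Cons.IH by (auto simp: replicate_append_eq_iff hd)
qed simp

lemma inj_on_L_iff:
  "inj_on (mhom mu) (L t) \<longleftrightarrow> \<not> (\<exists>m m'. collision (mu X) (\<lambda>i. mu (Z i)) t m m')"
  unfolding inj_on_def L_def collision_def mhom_Lword[symmetric]
  by (auto simp: Lword_eq_zword) (metis zword_inject)+

section \<open>The decision procedure\<close>

abbreviation numer :: "rat \<Rightarrow> int" where "numer q \<equiv> fst (quotient_of q)"
abbreviation denom :: "rat \<Rightarrow> int" where "denom q \<equiv> snd (quotient_of q)"

lemma numer_div_denom: "of_int (numer q) / of_int (denom q) = q"
  by (rule quotient_of_div[symmetric]) simp

lemma denom_nonzero [simp]: "denom q \<noteq> 0"
  by (metis quotient_of_denom_pos' less_irrefl)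

text \<open>The entries over the product of their three denominators, so that one denominator serves
  the whole matrix.\<close>

definition upP :: "rat^2^2 \<Rightarrow> int" where "upP A = numer (A$1$1) * denom (A$1$2) * denom (A$2$2)"
definition upQ :: "rat^2^2 \<Rightarrow> int" where "upQ A = denom (A$1$1) * numer (A$1$2) * denom (A$2$2)"
definition upR :: "rat^2^2 \<Rightarrow> int" where "upR A = denom (A$1$1) * denom (A$1$2) * numer (A$2$2)"
definition upD :: "rat^2^2 \<Rightarrow> int" where "upD A = denom (A$1$1) * denom (A$1$2) * denom (A$2$2)"

lemma upD_nonzero [simp]: "upD A \<noteq> 0"
  by (simp add: upD_def)

lemma upper_tri_eq:
  assumes "upper_tri A"
  shows "A = utm (of_int (upP A) / of_int (upD A)) (of_int (upQ A) / of_int (upD A)) (of_int (upR A) / of_int (upD A))"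
  by (subst upper_tri_eq_utm[OF assms]) (simp add: upP_def upQ_def upR_def upD_def numer_div_denom)

lemma up_nonzero:
  assumes "upper_tri A" "det A \<noteq> 0"
  shows "upP A \<noteq> 0" "upR A \<noteq> 0"
proof -
  have "A$1$1 \<noteq> 0" "A$2$2 \<noteq> 0"
    using assms by (auto simp: det_2 upper_tri_def)
  then have "numer (A$1$1) \<noteq> 0" "numer (A$2$2) \<noteq> 0"
    by (metis numer_div_denom div_0 of_int_0)+
  then show "upP A \<noteq> 0" "upR A \<noteq> 0"
    by (simp_all add: upP_def upR_def)
qed

lemma le_list_encode: "i \<in> set xs \<Longrightarrow> i \<le> list_encode xs"
proof (induction xs)
  case (Cons a xs)
  then show ?case
    using le_prod_encode_1[of a "list_encode xs"] le_prod_encode_2[of "list_encode xs" a] by auto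
qed simp

lemma abs_le_int_encode: "\<bar>i\<bar> \<le> int (int_encode i)"
  by (auto simp: int_encode_def sum_encode_def)

lemma enc_rat_bounds: "\<bar>numer q\<bar> \<le> int (enc_rat q)" "\<bar>denom q\<bar> \<le> int (enc_rat q)"
  using abs_le_int_encode[of "numer q"] abs_le_int_encode[of "denom q"]
    le_prod_encode_1[of "int_encode (numer q)" "int_encode (denom q)"]
    le_prod_encode_2[of "int_encode (denom q)" "int_encode (numer q)"]
  unfolding enc_rat_def by linarith+

lemma enc_mat_bounds:
  assumes "(i, j) \<in> {(1, 1), (1, 2), (2, 2)}" "enc_mat A \<le> n"
  shows "\<bar>numer (A$i$j)\<bar> \<le> int n" "\<bar>denom (A$i$j)\<bar> \<le> int n"
proof -
  have "enc_rat (A$i$j) \<le> enc_mat A"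
    unfolding enc_mat_def using assms(1) by (intro le_list_encode) auto
  then show "\<bar>numer (A$i$j)\<bar> \<le> int n" "\<bar>denom (A$i$j)\<bar> \<le> int n"
    using enc_rat_bounds[of "A$i$j"] assms(2) by linarith+
qed

lemma up_bounds:
  assumes "enc_mat A \<le> n"
  shows "\<bar>upP A\<bar> \<le> int (n ^ 3)" "\<bar>upQ A\<bar> \<le> int (n ^ 3)" "\<bar>upR A\<bar> \<le> int (n ^ 3)"
proof -
  have mul: "\<bar>a * b * c\<bar> \<le> int (n ^ 3)" if "\<bar>a\<bar> \<le> int n" "\<bar>b\<bar> \<le> int n" "\<bar>c\<bar> \<le> int n" for a b c
    using that by (auto simp: abs_mult power3_eq_cube intro!: mult_mono)
  show "\<bar>upP A\<bar> \<le> int (n ^ 3)" "\<bar>upQ A\<bar> \<le> int (n ^ 3)" "\<bar>upR A\<bar> \<le> int (n ^ 3)"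
    unfolding upP_def upQ_def upR_def by (intro mul enc_mat_bounds assms; simp)+
qed

section \<open>Computations with rational triangular matrices\<close>

text \<open>The fractions are not reduced: products need only integer ring operations, and equality
  is tested by cross multiplication.\<close>

definition computable_mat :: "'e set \<Rightarrow> ('e \<Rightarrow> nat list) \<Rightarrow> ('e \<Rightarrow> rat^2^2) \<Rightarrow> bool" where
  "computable_mat S v F \<longleftrightarrow> (\<exists>p q r d. computable_int S v p \<and> computable_int S v q \<and>
    computable_int S v r \<and> computable_int S v d \<and>
    (\<forall>e\<in>S. d e \<noteq> 0 \<and> F e =
      utm (of_int (p e) / of_int (d e)) (of_int (q e) / of_int (d e)) (of_int (r e) / of_int (d e))))"

lemma computable_matI:
  assumes "computable_int S v p" "computable_int S v q" "computable_int S v r" "computable_int S v d"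
    "\<And>e. e \<in> S \<Longrightarrow> d e \<noteq> 0" "\<And>e. e \<in> S \<Longrightarrow> F e =
      utm (of_int (p e) / of_int (d e)) (of_int (q e) / of_int (d e)) (of_int (r e) / of_int (d e))"
  shows "computable_mat S v F"
  using assms unfolding computable_mat_def by blast

lemma computable_matE:
  assumes "computable_mat S v F"
  obtains p q r d where
    "computable_int S v p" "computable_int S v q" "computable_int S v r" "computable_int S v d"
    "\<And>e. e \<in> S \<Longrightarrow> d e \<noteq> 0" "\<And>e. e \<in> S \<Longrightarrow> F e =
      utm (of_int (p e) / of_int (d e)) (of_int (q e) / of_int (d e)) (of_int (r e) / of_int (d e))"
  using assms unfolding computable_mat_def by blast

lemma computable_int_fst:
  "computable_int S v f \<Longrightarrow> computable_int (S \<times> UNIV) (ext v) (\<lambda>x. f (fst x))"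
  by (auto simp: computable_int_def intro: computable_fst)

lemma computable_mat_fst:
  assumes "computable_mat S v F"
  shows "computable_mat (S \<times> UNIV) (ext v) (\<lambda>x. F (fst x))"
proof -
  from assms obtain p q r d where *: "computable_int S v p" "computable_int S v q" "computable_int S v r"
    "computable_int S v d" and F: "\<And>e. e \<in> S \<Longrightarrow> d e \<noteq> 0" "\<And>e. e \<in> S \<Longrightarrow> F e =
      utm (of_int (p e) / of_int (d e)) (of_int (q e) / of_int (d e)) (of_int (r e) / of_int (d e))"
    by (rule computable_matE) blast
  show ?thesis
    by (rule computable_matI[OF *[THEN computable_int_fst]]) (use F in auto)
qed

lemma computable_mat_mult:
  assumes "computable_mat S v F" "computable_mat S v G"
  shows "computable_mat S v (\<lambda>e. F e ** G e)"
proof -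
  from assms(1) obtain p q r d where *: "computable_int S v p" "computable_int S v q" "computable_int S v r"
    "computable_int S v d" and F: "\<And>e. e \<in> S \<Longrightarrow> d e \<noteq> 0" "\<And>e. e \<in> S \<Longrightarrow> F e =
      utm (of_int (p e) / of_int (d e)) (of_int (q e) / of_int (d e)) (of_int (r e) / of_int (d e))"
    by (rule computable_matE) blast
  from assms(2) obtain p' q' r' d' where **: "computable_int S v p'" "computable_int S v q'" "computable_int S v r'"
    "computable_int S v d'" and G: "\<And>e. e \<in> S \<Longrightarrow> d' e \<noteq> 0" "\<And>e. e \<in> S \<Longrightarrow> G e =
      utm (of_int (p' e) / of_int (d' e)) (of_int (q' e) / of_int (d' e)) (of_int (r' e) / of_int (d' e))"
    by (rule computable_matE) blast
  have "computable_int S v (\<lambda>e. p e * p' e)" "computable_int S v (\<lambda>e. p e * q' e + q e * r' e)"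
    "computable_int S v (\<lambda>e. r e * r' e)" "computable_int S v (\<lambda>e. d e * d' e)"
    by (intro computable_int_mult computable_int_add * **)+
  then show ?thesis
    by (rule computable_matI) (use F G in \<open>simp_all add: add_divide_distrib\<close>)
qed

lemma computable_mat_mpow:
  assumes "computable_mat S v F" and n: "computable S v n"
  shows "computable_mat S v (\<lambda>e. mpow (F e) (n e))"
proof -
  from assms(1) obtain p q r d where *: "computable_int S v p" "computable_int S v q" "computable_int S v r"
    "computable_int S v d" and F: "\<And>e. e \<in> S \<Longrightarrow> d e \<noteq> 0" "\<And>e. e \<in> S \<Longrightarrow> F e =
      utm (of_int (p e) / of_int (d e)) (of_int (q e) / of_int (d e)) (of_int (r e) / of_int (d e))"
    by (rule computable_matE) blast
  have "computable_int S v (\<lambda>e. \<Sum>i<n e. (\<lambda>x. p (fst x) ^ snd x * q (fst x) *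
      r (fst x) ^ (n (fst x) - 1 - snd x)) (e, i))"
    by (intro computable_int_sum n computable_int_mult computable_int_power computable_int_fst
        computable_diff computable_snd[OF n] computable_fst[OF n] computable_const[OF computable_fst[OF n]] *)
  then have sum: "computable_int S v (\<lambda>e. \<Sum>i<n e. p e ^ i * q e * r e ^ (n e - 1 - i))"
    by simp
  \<comment> \<open>Each summand has \<open>k\<close> factors in all, hence the common denominator
    \<open>D ^ k\<close>.\<close>
  have pow: "(of_int P / of_int D) ^ i * (of_int Q / of_int D) * (of_int R / of_int D) ^ (k - 1 - i) =
      of_int (P ^ i * Q * R ^ (k - 1 - i)) / (of_int (D ^ k) :: rat)" if "i < k" "D \<noteq> 0" for P Q R D i k
  proof -
    have "D ^ k = D ^ i * D * D ^ (k - 1 - i)"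
    proof -
      have "D ^ k = D ^ Suc (i + (k - 1 - i))"
        using that(1) by simp
      then show ?thesis by (simp only: power_add power_Suc mult_ac)
    qed
    then show ?thesis by (simp add: power_divide)
  qed
  show ?thesis
  proof (rule computable_matI[OF computable_int_power[OF *(1) n] sum computable_int_power[OF *(3) n]
        computable_int_power[OF *(4) n]])
    fix e assume e: "e \<in> S"
    then show "d e ^ n e \<noteq> 0"
      using F(1) by simp
    show "mpow (F e) (n e) = utm (of_int (p e ^ n e) / of_int (d e ^ n e))
        (of_int (\<Sum>i<n e. p e ^ i * q e * r e ^ (n e - 1 - i)) / of_int (d e ^ n e))
        (of_int (r e ^ n e) / of_int (d e ^ n e))"
      unfolding F(2)[OF e] mpow_utm utm_eq_iff of_int_sum sum_divide_distrib
      by (intro conjI sum.cong refl pow F(1)[OF e]) (auto simp: power_divide)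
  qed
qed

lemma decidable_mat_eq:
  assumes "computable_mat S v F" "computable_mat S v G"
  shows "decidable S v (\<lambda>e. F e = G e)"
proof -
  from assms(1) obtain p q r d where *: "computable_int S v p" "computable_int S v q" "computable_int S v r"
    "computable_int S v d" and F: "\<And>e. e \<in> S \<Longrightarrow> d e \<noteq> 0" "\<And>e. e \<in> S \<Longrightarrow> F e =
      utm (of_int (p e) / of_int (d e)) (of_int (q e) / of_int (d e)) (of_int (r e) / of_int (d e))"
    by (rule computable_matE) blast
  from assms(2) obtain p' q' r' d' where **: "computable_int S v p'" "computable_int S v q'" "computable_int S v r'"
    "computable_int S v d'" and G: "\<And>e. e \<in> S \<Longrightarrow> d' e \<noteq> 0" "\<And>e. e \<in> S \<Longrightarrow> G e =
      utm (of_int (p' e) / of_int (d' e)) (of_int (q' e) / of_int (d' e)) (of_int (r' e) / of_int (d' e))"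
    by (rule computable_matE) blast
  have cross: "rat_of_int a / of_int b = of_int a' / of_int b' \<longleftrightarrow> a * b' = a' * b"
    if "b \<noteq> 0" "b' \<noteq> 0" for a b a' b'
    using that by (simp add: frac_eq_eq flip: of_int_mult)
  have "decidable S v (\<lambda>e. p e * d' e = p' e * d e \<and> q e * d' e = q' e * d e \<and> r e * d' e = r' e * d e)"
    by (intro decidable_conj decidable_int_eq computable_int_mult * **)
  then show ?thesis
    unfolding decidable_def
    by (rule computable_cong[rotated]) (simp add: cross F G)
qed

lemma computable_mat_wmat:
  assumes "computable_mat S v x" "\<forall>i\<in>{k..k + length fs}. computable_mat S v (z i)"
    "\<forall>f\<in>set fs. computable S v f"
  shows "computable_mat S v (\<lambda>e. wmat (x e) (\<lambda>i. z i e) (map (\<lambda>f. f e) fs) k)"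
  using assms
  by (induction fs arbitrary: k) (auto intro!: computable_mat_mult computable_mat_mpow)

text \<open>Total decoding at a prescribed length: every number yields a list of length
  \<open>n\<close>, so the search needs no validity test, and every list of that length is reached
  from its code.\<close>

primrec digits :: "nat \<Rightarrow> nat \<Rightarrow> nat list" where
  "digits 0 c = []"
| "digits (Suc n) c = fst (prod_decode (c - 1)) # digits n (snd (prod_decode (c - 1)))"

lemma length_digits [simp]: "length (digits n c) = n"
  by (induction n arbitrary: c) auto

lemma digits_list_encode: "digits (length m) (list_encode m) = m"
  by (induction m) auto

lemma computable_digits:
  assumes "computable S v c"
  shows "\<exists>fs. length fs = n \<and> (\<forall>f\<in>set fs. computable S v f) \<and> (\<forall>e. map (\<lambda>f. f e) fs = digits n (c e))"
  using assms
proof (induction n arbitrary: c)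
  case (Suc n)
  have "computable S v (\<lambda>e. prod_encode (fst (prod_decode (c e - 1)), snd (prod_decode (c e - 1))))"
    using computable_diff[OF Suc.prems computable_const[OF Suc.prems, of 1]] by simp
  note dec = computable_prod_decode[OF this]
  obtain fs where "length fs = n" "\<forall>f\<in>set fs. computable S v f"
    "\<forall>e. map (\<lambda>f. f e) fs = digits n (snd (prod_decode (c e - 1)))"
    using Suc.IH[OF dec(2)] by blast
  then show ?case
    using dec(1) by (intro exI[of _ "(\<lambda>e. fst (prod_decode (c e - 1))) # fs"]) auto
qed simp

lemma decidable_list_eq:
  assumes "computable S v h" "length fs = length gs"
    "\<forall>f\<in>set fs. computable S v f" "\<forall>g\<in>set gs. computable S v g"
  shows "decidable S v (\<lambda>e. map (\<lambda>f. f e) fs = map (\<lambda>g. g e) gs)"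
  using assms(2-)
proof (induction fs gs rule: list_induct2)
  case Nil
  show ?case
    using computable_const[OF assms(1), of 1] by (simp add: decidable_def)
next
  case (Cons f fs g gs)
  then show ?case
    by (simp add: decidable_conj decidable_eq)
qed

lemma triangle_mono: "m \<le> n \<Longrightarrow> triangle m \<le> triangle n"
  unfolding triangle_def by (intro div_le_mono mult_le_mono) auto

text \<open>The pairing function is monotone in both arguments. This turns a bound on the entries
  into a bound on the codes to be searched.\<close>

lemma list_encode_le_replicate:
  "\<forall>i\<in>set m. i \<le> b \<Longrightarrow> list_encode m \<le> list_encode (replicate (length m) b)"
  by (induction m) (auto simp: prod_encode_def intro!: add_mono triangle_mono)

text \<open>\<open>n\<close> is a constant of the program, so the recursion unfolds into finitely
  many compositions.\<close>

lemma computable_exponent_bound: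
  assumes "computable S v C" "computable S v K"
  shows "computable S v (\<lambda>e. exponent_bound (C e) (K e) n)"
  by (induction n)
    (auto simp del: add_Suc_right intro!: computable_const[OF assms(1)] computable_add computable_mult
      computable_power computable_Suc assms)

lemma computable_collision_bound:
  assumes N: "computable S v N"
  shows "computable S v (\<lambda>e. collision_bound t (N e))"
  unfolding collision_bound_def generic_bound_def
  by (intro computable_add computable_mult computable_power computable_exponent_bound N computable_const[OF N])

text \<open>The two codes are the bound variables of nested searches, so the test runs on inputs
  extended twice.\<close>

lemma decidable_collision_below:
  assumes x: "computable_mat S v x" and z: "\<forall>i\<in>{1..t + 1}. computable_mat S v (z i)"
    and b: "computable S v b"
  shows "decidable S v (\<lambda>e. \<exists>c<b e. \<exists>c'<b e. collision (x e) (\<lambda>i. z i e) t (digits t c) (digits t c'))"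
proof -
  let ?S = "(S \<times> UNIV) \<times> (UNIV :: nat set)" and ?v = "ext (ext v)"
  note b1 = computable_fst[OF b]
  note c = computable_fst[OF computable_snd[OF b]] and c' = computable_snd[OF b1]
  obtain fs where fs: "length fs = t" "\<forall>f\<in>set fs. computable ?S ?v f"
    "\<forall>y. map (\<lambda>f. f y) fs = digits t (snd (fst y))"
    using computable_digits[OF c, of t] by blast
  obtain gs where gs: "length gs = t" "\<forall>f\<in>set gs. computable ?S ?v f"
    "\<forall>y. map (\<lambda>f. f y) gs = digits t (snd y)"
    using computable_digits[OF c', of t] by blast
  note x2 = computable_mat_fst[OF computable_mat_fst[OF x]]
  have z2: "\<forall>i\<in>{1..1 + t}. computable_mat ?S ?v (\<lambda>y. z i (fst (fst y)))"
    using z computable_mat_fst[OF computable_mat_fst] by auto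
  have "decidable ?S ?v (\<lambda>y. \<not> map (\<lambda>f. f y) fs = map (\<lambda>g. g y) gs \<and>
      wmat (x (fst (fst y))) (\<lambda>i. z i (fst (fst y))) (map (\<lambda>f. f y) fs) 1 =
      wmat (x (fst (fst y))) (\<lambda>i. z i (fst (fst y))) (map (\<lambda>f. f y) gs) 1)"
    using fs gs x2 z2
    by (intro decidable_conj decidable_not decidable_list_eq[OF c] decidable_mat_eq computable_mat_wmat) auto
  then have "decidable ?S ?v (\<lambda>y. collision (x (fst (fst y))) (\<lambda>i. z i (fst (fst y))) t
      (digits t (snd (fst y))) (digits t (snd y)))"
    using fs(3) gs(3) by (simp add: collision_def)
  from decidable_ex[OF b decidable_ex[OF b1 this]] show ?thesis
    by simp
qed

lemma computable_mat_letter: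
  assumes "\<And>e. e \<in> S \<Longrightarrow> upper_tri (F e)" "computable S v (\<lambda>e. enc_mat (F e))"
  shows "computable_mat S v F"
proof -
  have "computable S v (\<lambda>e. list_encode (map (\<lambda>f. f e) (map (\<lambda>(i, j) e. enc_rat (F e $ i $ j)) [(1,1),(1,2),(2,1),(2,2)])))"
    using assms(2) by (simp add: enc_mat_def)
  note dec = computable_list_decode[OF this]
  have entry: "computable_int S v (\<lambda>e. numer (F e $ i $ j))" "computable_int S v (\<lambda>e. denom (F e $ i $ j))"
    if "(i, j) \<in> {(1, 1), (1, 2), (2, 2)}" for i j
  proof -
    have "computable S v (\<lambda>e. enc_rat (F e $ i $ j))"
      using that by (intro dec) auto
    from computable_prod_decode[OF this[unfolded enc_rat_def]]
    show "computable_int S v (\<lambda>e. numer (F e $ i $ j))" "computable_int S v (\<lambda>e. denom (F e $ i $ j))"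
      by (auto intro: computable_int_decode)
  qed
  have "computable_int S v (\<lambda>e. upP (F e))" "computable_int S v (\<lambda>e. upQ (F e))"
    "computable_int S v (\<lambda>e. upR (F e))" "computable_int S v (\<lambda>e. upD (F e))"
    unfolding upP_def upQ_def upR_def upD_def by (intro computable_int_mult entry; simp)+
  then show ?thesis
    by (rule computable_matI) (use upper_tri_eq[OF assms(1)] in simp_all)
qed

theorem theorem2p1:
  fixes t :: nat
  assumes "1 \<le> t"
  shows "\<exists>P :: recf. \<forall>mu :: letter \<Rightarrow> rat^2^2.
           (\<forall>a \<in> Sigma t. upper_tri (mu a)) \<and> (\<forall>i \<in> {1..t+1}. det (mu (Z i)) \<noteq> 0)
           \<longrightarrow> reval P [enc_input t mu] (if inj_on (mhom mu) (L t) then 1 else 0)"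
proof -
  define S where "S = {mu. (\<forall>a\<in>Sigma t. upper_tri (mu a)) \<and> (\<forall>i\<in>{1..t+1}. det (mu (Z i)) \<noteq> 0)}"
  define v where "v mu = [enc_input t mu]" for mu
  have "\<forall>mu\<in>S. length (v mu) = 1 \<and> reval (Proj 0) (v mu) (enc_input t mu)"
    by (auto simp: v_def intro: reval_proj_eq)
  then have input: "computable S v (enc_input t)"
    unfolding computable_def by blast
  have letters: "a \<in> set (X # map Z [1..<t + 2])" if "a \<in> Sigma t" for a
    using that by (auto simp: Sigma_def simp del: upt_Suc)
  have "computable S v (\<lambda>mu. list_encode (map (\<lambda>f. f mu) (map (\<lambda>a mu. enc_mat (mu a)) (X # map Z [1..<t + 2]))))"
    by (rule computable_cong[OF _ input]) (simp add: enc_input_def comp_def del: upt_Suc)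
  note dec = computable_list_decode[OF this]
  have mat: "computable_mat S v (\<lambda>mu. mu a)" if "a \<in> Sigma t" for a
  proof (rule computable_mat_letter)
    have "(\<lambda>mu. enc_mat (mu a)) \<in> set (map (\<lambda>a mu. enc_mat (mu a)) (X # map Z [1..<t + 2]))"
      using letters[OF that] unfolding set_map by (rule imageI)
    then show "computable S v (\<lambda>mu. enc_mat (mu a))"
      by (rule dec)
  qed (use that in \<open>simp add: S_def\<close>)
  have Z: "Z i \<in> Sigma t" if "i \<in> {1..t + 1}" for i
    using that by (simp add: Sigma_def)
  have XS: "X \<in> Sigma t"
    by (simp add: Sigma_def)
  \<comment> \<open>A code bounds every numerator and denominator inside it, and the integers
    representing a matrix are products of three of these.\<close>
  define N where "N mu = enc_input t mu ^ 3" for mu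
  \<comment> \<open>The largest code of an admissible list, plus one because the search range is
    strict.\<close>
  define b where "b mu = Suc (list_encode (replicate t (collision_bound t (N mu))))" for mu
  have b: "computable S v b"
    unfolding b_def N_def
    by (intro computable_Suc computable_list_encode computable_collision_bound computable_power
        input computable_const[OF input])
  have small: "(\<exists>c<b mu. \<exists>c'<b mu. collision (mu X) (\<lambda>i. mu (Z i)) t (digits t c) (digits t c')) \<longleftrightarrow>
      \<not> inj_on (mhom mu) (L t)" if mu: "mu \<in> S" for mu
  proof
    assume "\<not> inj_on (mhom mu) (L t)"
    then obtain m m' where c: "collision (mu X) (\<lambda>i. mu (Z i)) t m m'"
      using inj_on_L_iff by blast
    have ut: "upper_tri (mu a)" if "a \<in> Sigma t" for a
      using mu that by (simp add: S_def)
    have nz: "upP (mu (Z i)) \<noteq> 0 \<and> upR (mu (Z i)) \<noteq> 0 \<and> upD (mu (Z i)) \<noteq> 0" if "i \<in> {1..t + 1}" for i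
      using mu up_nonzero[OF ut[OF Z[OF that]]] that by (simp add: S_def)
    have "enc_mat (mu a) \<le> enc_input t mu" if "a \<in> Sigma t" for a
      unfolding enc_input_def using letters[OF that] by (intro le_list_encode) (simp del: upt_Suc, blast)
    note up = up_bounds[OF this, folded N_def]
    have "1 \<le> enc_input t mu"
      by (simp add: enc_input_def)
    then have N1: "1 \<le> N mu"
      by (simp add: N_def)
    have "collision_below (mu X) (\<lambda>i. mu (Z i)) t (collision_bound t (N mu))"
      by (rule collision_imp_below[where P = "\<lambda>i. upP (mu (Z i))" and Q = "\<lambda>i. upQ (mu (Z i))" and
          R = "\<lambda>i. upR (mu (Z i))" and D = "\<lambda>i. upD (mu (Z i))",
          OF assms N1 upper_tri_eq[OF ut[OF XS]] upD_nonzero up[OF XS] upper_tri_eq[OF ut[OF Z]] nz _ c])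
        (use up Z in auto)
    then obtain n n' where n: "collision (mu X) (\<lambda>i. mu (Z i)) t n n'"
      "\<forall>i\<in>set n \<union> set n'. i \<le> collision_bound t (N mu)"
      unfolding collision_below_def by blast
    then have len: "length n = t" "length n' = t"
      by (auto simp: collision_def)
    then have "list_encode n < b mu" "list_encode n' < b mu"
      using n(2) list_encode_le_replicate[of n "collision_bound t (N mu)"]
        list_encode_le_replicate[of n' "collision_bound t (N mu)"] by (auto simp: b_def)
    then show "\<exists>c<b mu. \<exists>c'<b mu. collision (mu X) (\<lambda>i. mu (Z i)) t (digits t c) (digits t c')"
      using n(1) digits_list_encode[of n] digits_list_encode[of n'] len by metis
  qed (use inj_on_L_iff in blast)
  have "decidable S v (\<lambda>mu. \<exists>c<b mu. \<exists>c'<b mu. collision (mu X) (\<lambda>i. mu (Z i)) t (digits t c) (digits t c'))"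
    using mat XS Z by (intro decidable_collision_below b) auto
  from computable_if[OF this computable_const[OF b, of 0] computable_const[OF b, of 1]]
  have "computable S v (\<lambda>mu. if inj_on (mhom mu) (L t) then 1 else 0)"
    by (rule computable_cong[rotated]) (simp add: small)
  then show ?thesis
    unfolding computable_def S_def v_def by blast
qed

end
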